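(* Let $\mathcal{M}$ be a finite factor with a faithful normal trace $\tau$. For $A,B\in\mathcal{M}$, the following conditions are equivalent. (1) $\omega_{C}(A)\leq\omega_{C}(B)$ for all operators $C\in\mathcal{M}$ that are not scalars and have nonzero trace. (2) $\omega_{C}(A)\leq\omega_{C}(B)$ for all operators $C\in\mathcal{M}$. (3) $A\in\Gamma$, where $\Gamma$ is the weak operator closure of $$K=\Big\{\sum_{i=1}^{n}z_{i}U_{i}BU_{i}^{*}\ \Big|\ n\in\mathbb{N},\ U_{1},\dots,U_{n}\in\mathscr{U}(\mathcal{M}),\ z_1,\dots,z_n\in\mathbb{C},\ \sum_{i=1}^{n}|z_{i}|\leq 1\Big\}.$$
   Context: A von Neumann algebra $\mathcal{M}$ on a Hilbert space is a factor if $\mathcal{M}\cap\mathcal{M}'=\mathbb{C}I$, and is finite if it has a faithful normal tracial state; $\tau$ denotes this faithful normal tracial state. All factors are assumed to have separable predual. $\mathscr{U}(\mathcal{M})$ is the set of unitary operators in $\mathcal{M}$. For $A,C\in\mathcal{M}$, the $C$-numerical radius of $A$ is $$\omega_{C}(A)=\sup_{U\in\mathscr{U}(\mathcal{M})}|\tau(CUAU^{*})|.$$ "Not a scalar" means not in $\mathbb{C}I$; "nonzero trace" means $\tau(C)\neq 0$.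
   Formalization: The equivalence of (1) and (2) is stated only when M is not the scalars CI: for M = CI condition (1) is vacuous, so A = 2I, B = I satisfies (1) but not (2). The equivalence of (2) and (3) is stated for every finite factor. *)

theory Defs
  imports "HOL-Analysis.Analysis"
begin

text \<open>
  Complex Hilbert spaces. The inner product is antilinear in the first and linear in the
  second argument. Positive definiteness is contained in the axiom relating \<open>cinner\<close>
  to the norm, and completeness is inherited from \<^class>\<open>banach\<close>.
\<close>

class chilbert_space = banach +
  fixes scaleC :: "complex \<Rightarrow> 'a \<Rightarrow> 'a"  (infixr "*\<^sub>C" 75)
    and cinner :: "'a \<Rightarrow> 'a \<Rightarrow> complex"
  assumes scaleC_add_right: "a *\<^sub>C (x + y) = a *\<^sub>C x + a *\<^sub>C y"
    and scaleC_add_left: "(a + b) *\<^sub>C x = a *\<^sub>C x + b *\<^sub>C x"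
    and scaleC_scaleC: "a *\<^sub>C (b *\<^sub>C x) = (a * b) *\<^sub>C x"
    and scaleC_of_real: "complex_of_real r *\<^sub>C x = r *\<^sub>R x"
    and cinner_commute: "cinner x y = cnj (cinner y x)"
    and cinner_add_right: "cinner x (y + z) = cinner x y + cinner x z"
    and cinner_scaleC_right: "cinner x (a *\<^sub>C y) = a * cinner x y"
    and cinner_self_eq_norm: "cinner x x = complex_of_real ((norm x)\<^sup>2)"

lemma cinner_scaleC_left: "cinner (a *\<^sub>C x) y = cnj a * cinner x y"
  by (metis cinner_commute cinner_scaleC_right complex_cnj_mult)

lemma norm_scaleC: "norm (a *\<^sub>C x) = cmod a * norm (x :: 'a::chilbert_space)"
proof -
  have "complex_of_real ((norm (a *\<^sub>C x))\<^sup>2) = (cnj a * a) * cinner x x"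
    by (simp add: cinner_self_eq_norm [symmetric] cinner_scaleC_left cinner_scaleC_right
        del: of_real_power)
  also have "\<dots> = complex_of_real ((cmod a)\<^sup>2) * complex_of_real ((norm x)\<^sup>2)"
    by (simp only: cinner_self_eq_norm complex_norm_square mult.commute)
  also have "\<dots> = complex_of_real ((cmod a * norm x)\<^sup>2)"
    by (simp add: power_mult_distrib)
  finally have "(norm (a *\<^sub>C x))\<^sup>2 = (cmod a * norm x)\<^sup>2"
    by (simp only: of_real_eq_iff)
  then show ?thesis
    by (simp add: power2_eq_iff_nonneg)
qed

lemma bounded_linear_scaleC: "bounded_linear (\<lambda>x :: 'a::chilbert_space. a *\<^sub>C x)"
proof (rule bounded_linear_intro [where K = "cmod a"])
  show "a *\<^sub>C (r *\<^sub>R x) = r *\<^sub>R (a *\<^sub>C x)" for r and x :: 'a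
    by (simp add: scaleC_scaleC mult.commute flip: scaleC_of_real)
qed (simp_all add: scaleC_add_right norm_scaleC mult.commute)

text \<open>
  The elements of \<^typ>\<open>'h \<Rightarrow>\<^sub>L 'h\<close> are the bounded real-linear maps;
  \<open>bounded_operators\<close> is the algebra of bounded complex-linear operators.
\<close>

definition bounded_operators :: "('h::chilbert_space \<Rightarrow>\<^sub>L 'h) set" where
  "bounded_operators = {T. \<forall>z x. blinfun_apply T (z *\<^sub>C x) = z *\<^sub>C blinfun_apply T x}"

lift_definition scale_op ::
    "complex \<Rightarrow> ('h::chilbert_space \<Rightarrow>\<^sub>L 'h) \<Rightarrow> ('h \<Rightarrow>\<^sub>L 'h)"
  is "\<lambda>z T x. z *\<^sub>C T x"
  by (rule bounded_linear_compose [OF bounded_linear_scaleC])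

definition adj :: "('h::chilbert_space \<Rightarrow>\<^sub>L 'h) \<Rightarrow> ('h \<Rightarrow>\<^sub>L 'h)" where
  "adj T = (THE S. \<forall>x y. cinner (blinfun_apply S x) y = cinner x (blinfun_apply T y))"

definition scalar_operators :: "('h::chilbert_space \<Rightarrow>\<^sub>L 'h) set" where
  "scalar_operators = range (\<lambda>z. scale_op z id_blinfun)"

definition weak_operator_topology :: "('h::chilbert_space \<Rightarrow>\<^sub>L 'h) topology" where
  "weak_operator_topology = topology_generated_by
     {{T \<in> bounded_operators. cinner x (blinfun_apply T y) \<in> W} | x y W. open W}"

definition ultraweak_topology :: "('h::chilbert_space \<Rightarrow>\<^sub>L 'h) topology" where
  "ultraweak_topology = topology_generated_by
     {{T \<in> bounded_operators. (\<Sum>n. cinner (x n) (blinfun_apply T (y n))) \<in> W} | x y W.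
        summable (\<lambda>n::nat. (norm (x n))\<^sup>2) \<and> summable (\<lambda>n. (norm (y n))\<^sup>2) \<and> open W}"

definition commutant :: "('h::chilbert_space \<Rightarrow>\<^sub>L 'h) set \<Rightarrow> ('h \<Rightarrow>\<^sub>L 'h) set" where
  "commutant M = {T \<in> bounded_operators. \<forall>S\<in>M. T o\<^sub>L S = S o\<^sub>L T}"

definition von_neumann_algebra :: "('h::chilbert_space \<Rightarrow>\<^sub>L 'h) set \<Rightarrow> bool" where
  "von_neumann_algebra M \<longleftrightarrow>
     M \<subseteq> bounded_operators \<and>
     id_blinfun \<in> M \<and>
     (\<forall>S\<in>M. \<forall>T\<in>M. S + T \<in> M) \<and>
     (\<forall>z. \<forall>T\<in>M. scale_op z T \<in> M) \<and>
     (\<forall>S\<in>M. \<forall>T\<in>M. S o\<^sub>L T \<in> M) \<and>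
     (\<forall>T\<in>M. adj T \<in> M) \<and>
     closedin weak_operator_topology M"

definition factor :: "('h::chilbert_space \<Rightarrow>\<^sub>L 'h) set \<Rightarrow> bool" where
  "factor M \<longleftrightarrow> von_neumann_algebra M \<and> M \<inter> commutant M = scalar_operators"

text \<open>
  Functionals on \<open>M\<close> are represented by total functions on \<^typ>\<open>'h \<Rightarrow>\<^sub>L 'h\<close>;
  only their values on \<open>M\<close> are constrained, and two of them that agree on \<open>M\<close>
  represent the same functional. The normal functionals are the ultraweakly continuous
  ones, and they form the predual of \<open>M\<close>.
\<close>

definition linear_functional_on ::
    "('h::chilbert_space \<Rightarrow>\<^sub>L 'h) set \<Rightarrow> (('h \<Rightarrow>\<^sub>L 'h) \<Rightarrow> complex) \<Rightarrow> bool" where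
  "linear_functional_on M \<phi> \<longleftrightarrow>
     (\<forall>S\<in>M. \<forall>T\<in>M. \<phi> (S + T) = \<phi> S + \<phi> T) \<and>
     (\<forall>z. \<forall>T\<in>M. \<phi> (scale_op z T) = z * \<phi> T)"

definition predual ::
    "('h::chilbert_space \<Rightarrow>\<^sub>L 'h) set \<Rightarrow> (('h \<Rightarrow>\<^sub>L 'h) \<Rightarrow> complex) set" where
  "predual M = {\<phi>. linear_functional_on M \<phi> \<and>
     continuous_map (subtopology ultraweak_topology M) euclidean \<phi>}"

text \<open>
  Separability for the functional norm: the last conjunct says that the norm of the
  restriction of \<open>\<phi> - \<psi>\<close> to \<open>M\<close> is at most \<open>\<epsilon>\<close>.
\<close>

definition separable_predual :: "('h::chilbert_space \<Rightarrow>\<^sub>L 'h) set \<Rightarrow> bool" where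
  "separable_predual M \<longleftrightarrow>
     (\<exists>D \<subseteq> predual M. countable D \<and>
       (\<forall>\<phi>\<in>predual M. \<forall>\<epsilon>>0. \<exists>\<psi>\<in>D. \<forall>T\<in>M. norm T \<le> 1 \<longrightarrow> cmod (\<phi> T - \<psi> T) \<le> \<epsilon>))"

definition faithful_normal_tracial_state ::
    "('h::chilbert_space \<Rightarrow>\<^sub>L 'h) set \<Rightarrow> (('h \<Rightarrow>\<^sub>L 'h) \<Rightarrow> complex) \<Rightarrow> bool" where
  "faithful_normal_tracial_state M \<tau> \<longleftrightarrow>
     \<tau> \<in> predual M \<and>
     \<tau> id_blinfun = 1 \<and>
     (\<forall>T\<in>M. \<tau> (adj T o\<^sub>L T) \<in> \<real>\<^sub>\<ge>\<^sub>0) \<and>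
     (\<forall>T\<in>M. \<tau> (adj T o\<^sub>L T) = 0 \<longrightarrow> T = 0) \<and>
     (\<forall>S\<in>M. \<forall>T\<in>M. \<tau> (S o\<^sub>L T) = \<tau> (T o\<^sub>L S))"

definition unitaries :: "('h::chilbert_space \<Rightarrow>\<^sub>L 'h) set \<Rightarrow> ('h \<Rightarrow>\<^sub>L 'h) set" where
  "unitaries M = {U \<in> M. adj U o\<^sub>L U = id_blinfun \<and> U o\<^sub>L adj U = id_blinfun}"

text \<open>
  The supremum is taken in \<^typ>\<open>real\<close>. It is that of a nonempty set which, for a tracial
  state \<open>\<tau>\<close> and \<open>A, C \<in> M\<close>, is bounded above by \<open>norm C * norm A\<close>.
\<close>

definition numerical_radius ::
    "('h::chilbert_space \<Rightarrow>\<^sub>L 'h) set \<Rightarrow> (('h \<Rightarrow>\<^sub>L 'h) \<Rightarrow> complex) \<Rightarrow>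
     ('h \<Rightarrow>\<^sub>L 'h) \<Rightarrow> ('h \<Rightarrow>\<^sub>L 'h) \<Rightarrow> real" where
  "numerical_radius M \<tau> C A = (SUP U\<in>unitaries M. cmod (\<tau> (C o\<^sub>L U o\<^sub>L A o\<^sub>L adj U)))"

definition abs_convex_unitary_orbit ::
    "('h::chilbert_space \<Rightarrow>\<^sub>L 'h) set \<Rightarrow> ('h \<Rightarrow>\<^sub>L 'h) \<Rightarrow> ('h \<Rightarrow>\<^sub>L 'h) set" where
  "abs_convex_unitary_orbit M B =
     {(\<Sum>i=1..n. scale_op (z i) (U i o\<^sub>L B o\<^sub>L adj (U i))) | (n::nat) U z.
        (\<forall>i\<in>{1..n}. U i \<in> unitaries M) \<and> (\<Sum>i=1..n. cmod (z i)) \<le> 1}"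

end

theory Submission
  imports Defs
begin

text \<open>
  That (2) follows from (1) is a density argument: the numerical radius is a seminorm in \<open>C\<close>,
  and the nonscalar operators of nonzero trace are norm dense in \<open>M\<close> unless \<open>M\<close> is trivial
  (\<open>numerical_radius_le_from_nonscalar_nonzero_trace\<close>).

  That (3) implies (2) holds because \<open>T \<mapsto> \<tau> (C U T adj U)\<close> is weakly continuous on bounded sets
  and its modulus is at most the numerical radius of \<open>B\<close> on the absolutely convex hull \<open>K\<close> of the
  unitary orbit (\<open>numerical_radius_le_if_in_closure\<close>).

  The substance is that (2) implies (3). A Hahn--Banach separation of \<open>A\<close> from the weak closure
  of \<open>K\<close> would produce a normal functional, which would still have to be approximated by
  functionals \<open>\<tau> (C \<cdot>)\<close> with \<open>C \<in> M\<close>. This duality is avoided by separating in the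
  pre-Hilbert space \<open>M\<close> with inner product \<open>\<tau> (adj S T)\<close>: if \<open>A\<close> has positive distance from \<open>K\<close>
  there, an almost nearest point \<open>P\<close> gives a separating functional \<open>\<tau> (C \<cdot>)\<close> with
  \<open>C = adj (A - P) \<in> M\<close>, for which (2) fails (\<open>orbit_hull_approximates\<close>). Hence some sequence in
  \<open>K\<close> converges to \<open>A\<close> in the norm given by \<open>\<tau>\<close>. As \<open>K\<close> is bounded, the sequence has a weak cluster
  point \<open>S\<close> (\<open>bounded_sequence_weak_cluster_point\<close>), and normality and faithfulness of \<open>\<tau>\<close> force
  \<open>S = A\<close> (\<open>in_closure_if_numerical_radius_le\<close>).

  The Hilbert space tools behind this are Riesz representation, which provides adjoints and turns
  bounded sesquilinear forms into operators, and the fact that a normal functional respects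
  bounded weak limits (\<open>predual_tendsto\<close>).
\<close>

section \<open>The inner product\<close>

lemma scaleC_zero_left [simp]: "0 *\<^sub>C x = (0 :: 'h::chilbert_space)"
  using scaleC_of_real [of 0 x] by simp

lemma scaleC_one [simp]: "1 *\<^sub>C x = (x :: 'h::chilbert_space)"
  using scaleC_of_real [of 1 x] by simp

lemma scaleC_minus_left: "(- a) *\<^sub>C x = - (a *\<^sub>C (x :: 'h::chilbert_space))"
  by (metis add.right_inverse minus_unique scaleC_add_left scaleC_zero_left)

lemma scaleC_diff_left: "(a - b) *\<^sub>C x = a *\<^sub>C x - b *\<^sub>C (x :: 'h::chilbert_space)"
  using scaleC_add_left [of a "- b" x] by (simp add: scaleC_minus_left)

lemma scaleC_diff_right: "a *\<^sub>C (x - y) = a *\<^sub>C x - a *\<^sub>C (y :: 'h::chilbert_space)"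
  by (metis add_diff_cancel diff_add_cancel scaleC_add_right)

lemma cinner_add_left: "cinner (x + y) z = cinner x z + cinner y z"
  for x y z :: "'h::chilbert_space"
  by (metis cinner_add_right cinner_commute complex_cnj_add)

lemma cinner_zero_right [simp]: "cinner x (0 :: 'h::chilbert_space) = 0"
  by (metis add_cancel_right_right cinner_add_right)

lemma cinner_minus_right: "cinner x (- y) = - cinner x (y :: 'h::chilbert_space)"
  by (metis add.right_inverse cinner_add_right cinner_zero_right minus_unique)

lemma cinner_diff_right: "cinner x (y - z) = cinner x y - cinner x (z :: 'h::chilbert_space)"
  using cinner_add_right [of x y "- z"] by (simp add: cinner_minus_right)

lemma cinner_scaleR_right: "cinner x (r *\<^sub>R y) = of_real r * cinner x (y :: 'h::chilbert_space)"
  by (metis cinner_scaleC_right scaleC_of_real)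

lemma cinner_scaleR_left: "cinner (r *\<^sub>R x) y = of_real r * cinner x (y :: 'h::chilbert_space)"
  by (metis cinner_scaleC_left complex_cnj_complex_of_real scaleC_of_real)

lemma cinner_ext:
  fixes y z :: "'h::chilbert_space"
  assumes "\<And>x. cinner x y = cinner x z"
  shows "y = z"
proof -
  have "cinner (y - z) (y - z) = 0"
    using assms by (simp add: cinner_diff_right)
  then show ?thesis
    by (simp add: cinner_self_eq_norm)
qed

lemma norm_add_squared:
  fixes x y :: "'h::chilbert_space"
  shows "(norm (x + y))\<^sup>2 = (norm x)\<^sup>2 + 2 * Re (cinner x y) + (norm y)\<^sup>2"
proof -
  have "complex_of_real ((norm (x + y))\<^sup>2) =
      complex_of_real ((norm x)\<^sup>2) + (cinner x y + cnj (cinner x y)) + complex_of_real ((norm y)\<^sup>2)"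
    by (metis (no_types, lifting) add.assoc cinner_add_left cinner_add_right cinner_commute
        cinner_self_eq_norm)
  also have "\<dots> = complex_of_real ((norm x)\<^sup>2 + 2 * Re (cinner x y) + (norm y)\<^sup>2)"
    by (simp add: complex_add_cnj)
  finally show ?thesis
    by (simp only: of_real_eq_iff)
qed

text \<open>
  The triangle inequality of the norm already bounds the real part of \<open>cinner x y\<close>;
  rotating \<open>y\<close> makes \<open>cinner x y\<close> real.
\<close>

lemma cinner_Cauchy_Schwarz:
  fixes x y :: "'h::chilbert_space"
  shows "cmod (cinner x y) \<le> norm x * norm y"
proof -
  have Re_le: "Re (cinner x v) \<le> norm x * norm v" for v
  proof -
    have "(norm (x + v))\<^sup>2 \<le> (norm x + norm v)\<^sup>2"
      by (intro power_mono norm_triangle_ineq) simp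
    then show ?thesis
      by (simp add: norm_add_squared power2_sum)
  qed
  define w where "w = cinner x y"
  show ?thesis
  proof (cases "w = 0")
    case True
    then show ?thesis by (simp add: w_def)
  next
    case False
    define a where "a = cnj w / of_real (cmod w)"
    have a: "cmod a = 1" "a * w = of_real (cmod w)"
      using False complex_norm_square [of w]
      by (simp_all add: a_def norm_divide power2_eq_square mult.commute nonzero_divide_eq_eq)
    have "cmod w = Re (cinner x (a *\<^sub>C y))"
      using a(2) by (simp add: cinner_scaleC_right flip: w_def)
    also have "\<dots> \<le> norm x * norm (a *\<^sub>C y)"
      by (rule Re_le)
    finally show ?thesis
      by (simp add: norm_scaleC a(1) w_def)
  qed
qed

lemma bounded_bilinear_cinner:
  "bounded_bilinear (cinner :: 'h::chilbert_space \<Rightarrow> 'h \<Rightarrow> complex)"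
  by (unfold_locales; (simp add: cinner_add_left cinner_add_right cinner_scaleR_left
        cinner_scaleR_right scaleR_conv_of_real)?)
    (metis cinner_Cauchy_Schwarz mult_1_right)

section \<open>Bounded forms and adjoints\<close>

text \<open>
  The vector representing \<open>f\<close> minimises \<open>norm y ^ 2 - 2 * Re (f y)\<close>: this is
  \<open>norm (y - u) ^ 2 - norm u ^ 2\<close> if \<open>u\<close> represents \<open>f\<close>. Minimising sequences are Cauchy by the
  parallelogram law, so the minimum is attained by completeness.
\<close>

lemma Riesz_representation:
  fixes f :: "'h::chilbert_space \<Rightarrow> complex"
  assumes f: "bounded_linear f" and fC: "\<And>z x. f (z *\<^sub>C x) = z * f x"
  obtains u where "\<And>y. f y = cinner u y"
proof -
  interpret f: bounded_linear f by (rule f)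
  obtain K where K: "\<And>x. norm (f x) \<le> norm x * K"
    using f.bounded by blast
  define J where "J y = (norm y)\<^sup>2 - 2 * Re (f y)" for y
  have J_lower: "- K\<^sup>2 \<le> J y" for y
  proof -
    have "Re (f y) \<le> norm y * K"
      using K [of y] complex_Re_le_cmod [of "f y"] by linarith
    then show ?thesis
      using zero_le_power2 [of "norm y - K"] by (simp add: J_def power2_diff)
  qed
  define m where "m = Inf (range J)"
  have bdd: "bdd_below (range J)"
    using J_lower by (intro bdd_belowI [of _ "- K\<^sup>2"]) auto
  have m_le: "m \<le> J y" for y
    unfolding m_def by (rule cInf_lower [OF _ bdd]) simp
  have "\<exists>y. J y < m + inverse (real (Suc n))" for n
  proof -
    have "Inf (range J) < m + inverse (real (Suc n))"
      by (simp add: m_def)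
    then show ?thesis
      using cInf_lessD [of "range J"] by blast
  qed
  then obtain s where s: "\<And>n. J (s n) < m + inverse (real (Suc n))"
    by metis
  have J_lim: "(\<lambda>n. J (s n)) \<longlonglongrightarrow> m"
  proof (rule tendsto_sandwich)
    show "eventually (\<lambda>n. m \<le> J (s n)) sequentially"
      by (simp add: m_le)
    show "eventually (\<lambda>n. J (s n) \<le> m + inverse (real (Suc n))) sequentially"
      by (intro always_eventually allI less_imp_le s)
    show "(\<lambda>n. m + inverse (real (Suc n))) \<longlonglongrightarrow> m"
      using tendsto_add [OF tendsto_const LIMSEQ_inverse_real_of_nat] by simp
  qed simp
  have parallelogram: "(norm (a - b))\<^sup>2 \<le> 2 * (J a + J b - 2 * m)" for a b
  proof -
    have mid: "J ((1/2) *\<^sub>R (a + b)) = (norm (a + b))\<^sup>2 / 4 - Re (f a) - Re (f b)"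
      by (simp add: J_def f.scaleR f.add power_mult_distrib power2_eq_square add_divide_distrib
          del: scaleR_add_right)
    have "(norm (a - b))\<^sup>2 + (norm (a + b))\<^sup>2 = 2 * (norm a)\<^sup>2 + 2 * (norm b)\<^sup>2"
      using norm_add_squared [of a b] norm_add_squared [of a "- b"]
      by (simp add: cinner_minus_right)
    then show ?thesis
      using m_le [of "(1/2) *\<^sub>R (a + b)"] unfolding mid by (simp add: J_def)
  qed
  have "Cauchy s"
  proof (rule metric_CauchyI)
    fix e :: real assume "0 < e"
    then have "eventually (\<lambda>n. J (s n) < m + e\<^sup>2 / 4) sequentially"
      using order_tendstoD(2) [OF J_lim, of "m + e\<^sup>2 / 4"] by simp
    then obtain N where N: "\<And>n. n \<ge> N \<Longrightarrow> J (s n) < m + e\<^sup>2 / 4"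
      by (auto simp: eventually_sequentially)
    have "dist (s i) (s j) < e" if "i \<ge> N" "j \<ge> N" for i j
    proof -
      have "(norm (s i - s j))\<^sup>2 < e\<^sup>2"
        using parallelogram [of "s i" "s j"] N [OF that(1)] N [OF that(2)] by simp
      then show ?thesis
        using \<open>0 < e\<close> by (simp add: dist_norm power_less_imp_less_base)
    qed
    then show "\<exists>N. \<forall>i\<ge>N. \<forall>j\<ge>N. dist (s i) (s j) < e" by blast
  qed
  then obtain u where u: "s \<longlonglongrightarrow> u"
    using Cauchy_convergent convergent_def by blast
  have "(\<lambda>n. J (s n)) \<longlonglongrightarrow> J u"
    unfolding J_def by (intro tendsto_intros f.tendsto u)
  then have Ju: "J u = m"
    using J_lim LIMSEQ_unique by blast
  have Re_eq: "Re (f y) = Re (cinner u y)" for y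
  proof -
    define c where "c = Re (cinner u y) - Re (f y)"
    have ineq: "0 \<le> 2 * t * c + t\<^sup>2 * (norm y)\<^sup>2" for t :: real
    proof -
      have "J (u + t *\<^sub>R y) = J u + 2 * t * c + t\<^sup>2 * (norm y)\<^sup>2"
        by (simp add: J_def norm_add_squared f.add f.scaleR cinner_scaleR_right c_def
            power_mult_distrib algebra_simps)
      then show ?thesis
        using m_le [of "u + t *\<^sub>R y"] Ju by simp
    qed
    have "c = 0"
    proof (rule ccontr)
      assume "c \<noteq> 0"
      define t where "t = - c / (1 + (norm y)\<^sup>2)"
      have pos: "0 < 1 + (norm y)\<^sup>2"
        by (simp add: add_pos_nonneg)
      have "t\<^sup>2 * (norm y)\<^sup>2 \<le> t\<^sup>2 * (1 + (norm y)\<^sup>2)"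
        by (intro mult_left_mono) auto
      also have "\<dots> = - t * c"
        using pos by (simp add: t_def power2_eq_square)
      finally have "0 \<le> t * c"
        using ineq [of t] by simp
      moreover have "t * c = - (c\<^sup>2 / (1 + (norm y)\<^sup>2))"
        by (simp add: t_def power2_eq_square)
      moreover have "0 < c\<^sup>2 / (1 + (norm y)\<^sup>2)"
        using pos \<open>c \<noteq> 0\<close> by simp
      ultimately show False by linarith
    qed
    then show ?thesis by (simp add: c_def)
  qed
  have "f y = cinner u y" for y
  proof (rule complex_eqI)
    show "Im (f y) = Im (cinner u y)"
      using Re_eq [of "\<i> *\<^sub>C y"] by (simp add: fC cinner_scaleC_right)
  qed (rule Re_eq)
  then show thesis by (rule that)
qed

lemma bounded_form_represented:
  fixes s :: "'h::chilbert_space \<Rightarrow> 'h \<Rightarrow> complex"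
  assumes add_left: "\<And>x y z. s (x + y) z = s x z + s y z"
    and scale_left: "\<And>a x y. s (a *\<^sub>C x) y = cnj a * s x y"
    and add_right: "\<And>x y z. s x (y + z) = s x y + s x z"
    and scale_right: "\<And>a x y. s x (a *\<^sub>C y) = a * s x y"
    and bound: "\<And>x y. cmod (s x y) \<le> r * norm x * norm y"
  obtains S where "S \<in> bounded_operators" "\<And>x y. s x y = cinner x (blinfun_apply S y)"
proof -
  have "\<exists>u. \<forall>x. cnj (s x y) = cinner u x" for y
  proof -
    have "bounded_linear (\<lambda>x. cnj (s x y))"
    proof (rule bounded_linear_intro [where K = "r * norm y"])
      show "cnj (s (c *\<^sub>R x) y) = c *\<^sub>R cnj (s x y)" for c x
        by (simp add: scale_left scaleR_conv_of_real flip: scaleC_of_real)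
      show "norm (cnj (s x y)) \<le> norm x * (r * norm y)" for x
        using bound [of x y] by (simp add: mult.commute mult.left_commute)
    qed (simp add: add_left)
    then show ?thesis
      by (rule Riesz_representation) (auto simp: scale_left)
  qed
  then obtain g where g: "\<And>x y. cnj (s x y) = cinner (g y) x"
    by metis
  then have g': "s x y = cinner x (g y)" for x y
    by (metis cinner_commute complex_cnj_cnj)
  have gC: "g (a *\<^sub>C y) = a *\<^sub>C g y" for a y
    by (rule cinner_ext) (simp add: scale_right cinner_scaleC_right flip: g')
  have "bounded_linear g"
  proof (rule bounded_linear_intro [where K = "\<bar>r\<bar>"])
    show "g (x + y) = g x + g y" for x y
      by (rule cinner_ext) (simp add: add_right cinner_add_right flip: g')
    show "g (c *\<^sub>R x) = c *\<^sub>R g x" for c x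
      by (metis gC scaleC_of_real)
    show "norm (g y) \<le> norm y * \<bar>r\<bar>" for y
    proof (cases "norm (g y) = 0")
      case False
      have "(norm (g y))\<^sup>2 = cmod (s (g y) y)"
        by (simp add: g' cinner_self_eq_norm norm_power)
      also have "\<dots> \<le> \<bar>r\<bar> * norm (g y) * norm y"
        by (rule order_trans [OF bound]) (intro mult_right_mono; simp)
      finally show ?thesis
        using False by (simp add: power2_eq_square mult.commute mult.left_commute)
    qed simp
  qed
  then have app: "blinfun_apply (Blinfun g) = g"
    by (rule bounded_linear_Blinfun_apply)
  show thesis
  proof (rule that)
    show "Blinfun g \<in> bounded_operators"
      by (simp add: bounded_operators_def app gC)
    show "s x y = cinner x (blinfun_apply (Blinfun g) y)" for x y
      by (simp add: app g')
  qed
qed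

lemma bounded_operatorsD:
  "T \<in> bounded_operators \<Longrightarrow> blinfun_apply T (z *\<^sub>C x) = z *\<^sub>C blinfun_apply T x"
  by (simp add: bounded_operators_def)

lemma adj_unique:
  assumes "\<And>x y. cinner (blinfun_apply S x) y = cinner x (blinfun_apply T y)"
  shows "adj T = S"
  unfolding adj_def
proof (rule the_equality)
  fix R assume R: "\<forall>x y. cinner (blinfun_apply R x) y = cinner x (blinfun_apply T y)"
  show "R = S"
  proof (rule blinfun_eqI, rule cinner_ext)
    fix x y
    show "cinner y (blinfun_apply R x) = cinner y (blinfun_apply S x)"
      using R assms by (metis cinner_commute)
  qed
qed (use assms in blast)

text \<open>
  The form \<open>cinner (T x) y\<close> is represented by an operator, which gives the existence behind the
  definite description of \<open>adj T\<close>.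
\<close>

lemma cinner_adj_left:
  assumes T: "T \<in> bounded_operators"
  shows "cinner (blinfun_apply (adj T) x) y = cinner x (blinfun_apply T y)"
proof -
  obtain S where S: "\<And>x y. cinner (blinfun_apply T x) y = cinner x (blinfun_apply S y)"
  proof (rule bounded_form_represented [where s = "\<lambda>x y. cinner (blinfun_apply T x) y"
        and r = "norm T"])
    show "cmod (cinner (blinfun_apply T x) y) \<le> norm T * norm x * norm y" for x y
      by (rule order_trans [OF cinner_Cauchy_Schwarz]) (intro mult_right_mono norm_blinfun; simp)
  qed (simp_all add: blinfun.add_right cinner_add_left cinner_add_right cinner_scaleC_left
      cinner_scaleC_right bounded_operatorsD [OF T])
  have "adj T = S"
    by (rule adj_unique) (metis S cinner_commute)
  then show ?thesis
    by (metis S cinner_commute)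
qed

lemma cinner_adj_right:
  assumes "T \<in> bounded_operators"
  shows "cinner x (blinfun_apply (adj T) y) = cinner (blinfun_apply T x) y"
  by (metis assms cinner_adj_left cinner_commute)

lemma scale_op_apply [simp]: "blinfun_apply (scale_op z T) x = z *\<^sub>C blinfun_apply T x"
  by (simp add: scale_op.rep_eq)

lemma adj_add:
  "S \<in> bounded_operators \<Longrightarrow> T \<in> bounded_operators \<Longrightarrow> adj (S + T) = adj S + adj T"
  by (rule adj_unique)
    (simp add: blinfun.add_left cinner_add_left cinner_add_right cinner_adj_left)

lemma adj_scale_op: "T \<in> bounded_operators \<Longrightarrow> adj (scale_op z T) = scale_op (cnj z) (adj T)"
  by (rule adj_unique) (simp add: cinner_scaleC_left cinner_scaleC_right cinner_adj_left)

lemma adj_compose: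
  "S \<in> bounded_operators \<Longrightarrow> T \<in> bounded_operators \<Longrightarrow> adj (S o\<^sub>L T) = adj T o\<^sub>L adj S"
  by (rule adj_unique) (simp add: cinner_adj_left)

lemma norm_adj_le:
  assumes "T \<in> bounded_operators"
  shows "norm (adj T) \<le> norm T"
proof (rule norm_blinfun_bound)
  fix x
  let ?y = "blinfun_apply (adj T) x"
  show "norm ?y \<le> norm T * norm x"
  proof (cases "norm ?y = 0")
    case False
    have "(norm ?y)\<^sup>2 = cmod (cinner x (blinfun_apply T ?y))"
      by (simp add: cinner_self_eq_norm norm_power flip: cinner_adj_left [OF assms])
    also have "\<dots> \<le> norm x * (norm T * norm ?y)"
      by (rule order_trans [OF cinner_Cauchy_Schwarz]) (intro mult_left_mono norm_blinfun; simp)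
    finally show ?thesis
      using False by (simp add: power2_eq_square mult.commute mult.left_commute)
  qed simp
qed simp

lemma adj_adj: "T \<in> bounded_operators \<Longrightarrow> adj (adj T) = T"
  by (rule adj_unique) (simp add: cinner_adj_right)

lemma compose_id [simp]: "id_blinfun o\<^sub>L T = T" "T o\<^sub>L id_blinfun = T"
  by (auto intro: blinfun_eqI)

lemma adj_id: "adj id_blinfun = (id_blinfun :: 'h::chilbert_space \<Rightarrow>\<^sub>L 'h)"
  by (rule adj_unique) simp

section \<open>Weak convergence along a filter\<close>

text \<open>
  Limits along arbitrary filters serve as limits of nets: closures in the weak operator topology
  need not be sequential, because the Hilbert space may be nonseparable.
\<close>

definition weakly_tendsto ::
    "('i \<Rightarrow> 'h::chilbert_space \<Rightarrow>\<^sub>L 'h) \<Rightarrow> ('h \<Rightarrow>\<^sub>L 'h) \<Rightarrow> 'i filter \<Rightarrow> bool" where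
  "weakly_tendsto T S F \<longleftrightarrow>
     (\<forall>x y. ((\<lambda>i. cinner x (blinfun_apply (T i) y)) \<longlongrightarrow> cinner x (blinfun_apply S y)) F)"

lemma weakly_tendstoD:
  "weakly_tendsto T S F \<Longrightarrow>
     ((\<lambda>i. cinner x (blinfun_apply (T i) y)) \<longlongrightarrow> cinner x (blinfun_apply S y)) F"
  by (simp add: weakly_tendsto_def)

lemma weakly_tendsto_compose_right:
  "weakly_tendsto T S F \<Longrightarrow> weakly_tendsto (\<lambda>i. T i o\<^sub>L R) (S o\<^sub>L R) F"
  by (simp add: weakly_tendsto_def)

lemma weakly_tendsto_compose_left:
  assumes "R \<in> bounded_operators" "weakly_tendsto T S F"
  shows "weakly_tendsto (\<lambda>i. R o\<^sub>L T i) (R o\<^sub>L S) F"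
  using assms by (simp add: weakly_tendsto_def flip: cinner_adj_left)

lemma weakly_tendsto_diff:
  "weakly_tendsto T S F \<Longrightarrow> weakly_tendsto (\<lambda>i. R - T i) (R - S) F"
  by (auto simp: weakly_tendsto_def blinfun.diff_left cinner_diff_right intro!: tendsto_intros)

lemma norm_tendsto_imp_weakly_tendsto:
  assumes "(T \<longlongrightarrow> S) F"
  shows "weakly_tendsto T S F"
  unfolding weakly_tendsto_def
  by (intro allI bounded_bilinear.tendsto [OF bounded_bilinear_cinner]
      blinfun.tendsto tendsto_const assms)

lemma limitin_topology_generated_by:
  assumes "l \<in> \<Union>\<S>" and "\<And>U. U \<in> \<S> \<Longrightarrow> l \<in> U \<Longrightarrow> eventually (\<lambda>i. f i \<in> U) F"
  shows "limitin (topology_generated_by \<S>) f l F"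
proof -
  have "l \<in> U \<longrightarrow> eventually (\<lambda>i. f i \<in> U) F" if "generate_topology_on \<S> U" for U
    using that
  proof induction
    case (Int a b)
    then show ?case by (auto intro: eventually_conj)
  next
    case (UN K)
    show ?case
    proof
      assume "l \<in> \<Union>K"
      then obtain k where "k \<in> K" "l \<in> k" by blast
      then have "eventually (\<lambda>i. f i \<in> k) F"
        using UN by blast
      then show "eventually (\<lambda>i. f i \<in> \<Union>K) F"
        by (rule eventually_mono) (use \<open>k \<in> K\<close> in blast)
    qed
  qed (use assms in auto)
  then show ?thesis
    using assms(1) by (simp add: limitin_def openin_topology_generated_by_iff)
qed

lemma limitin_weak_operator_topology:
  assumes "S \<in> bounded_operators" "eventually (\<lambda>i. T i \<in> bounded_operators) F"
    and "weakly_tendsto T S F"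
  shows "limitin weak_operator_topology T S F"
  unfolding weak_operator_topology_def
proof (rule limitin_topology_generated_by)
  show "S \<in> \<Union> {{T \<in> bounded_operators. cinner x (blinfun_apply T y) \<in> W} | x y W. open W}"
    by (rule UnionI [of bounded_operators])
      (use assms(1) in \<open>auto intro!: exI [of _ "UNIV :: complex set"]\<close>)
next
  fix U assume "U \<in> {{T \<in> bounded_operators. cinner x (blinfun_apply T y) \<in> W} | x y W. open W}"
    and S: "S \<in> U"
  then obtain x y W where U: "U = {T \<in> bounded_operators. cinner x (blinfun_apply T y) \<in> W}"
    and W: "open W"
    by blast
  have "eventually (\<lambda>i. cinner x (blinfun_apply (T i) y) \<in> W) F"
    using S U W weakly_tendstoD [OF assms(3)] by (intro topological_tendstoD) auto
  with assms(2) show "eventually (\<lambda>i. T i \<in> U) F"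
    by eventually_elim (simp add: U)
qed

text \<open>
  On a bounded set the series defining the ultraweakly open sets are uniformly dominated, so
  weak convergence passes through them (Tannery) and already implies ultraweak convergence.
\<close>

lemma predual_tendsto:
  assumes \<phi>: "\<phi> \<in> predual M" and M: "M \<subseteq> bounded_operators" "S \<in> M"
    and ev: "eventually (\<lambda>i. T i \<in> M \<and> norm (T i) \<le> r) F"
    and weak: "weakly_tendsto T S F"
  shows "((\<lambda>i. \<phi> (T i)) \<longlongrightarrow> \<phi> S) F"
proof (cases "F = bot")
  case False
  have series: "((\<lambda>i. \<Sum>n. cinner (x n) (blinfun_apply (T i) (y n))) \<longlongrightarrow>
      (\<Sum>n. cinner (x n) (blinfun_apply S (y n)))) F"
    if sx: "summable (\<lambda>n. (norm (x n))\<^sup>2)" and sy: "summable (\<lambda>n. (norm (y n))\<^sup>2)"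
    for x y :: "nat \<Rightarrow> 'a"
  proof -
    have bd: "cmod (cinner (x n) (blinfun_apply R (y n)))
        \<le> \<bar>r\<bar> * ((norm (x n))\<^sup>2 + (norm (y n))\<^sup>2)"
      if "norm R \<le> r" for R n
    proof -
      have "cmod (cinner (x n) (blinfun_apply R (y n))) \<le> norm (x n) * (norm R * norm (y n))"
        by (rule order_trans [OF cinner_Cauchy_Schwarz]) (intro mult_left_mono norm_blinfun; simp)
      also have "\<dots> = norm R * (norm (x n) * norm (y n))"
        by simp
      also have "\<dots> \<le> \<bar>r\<bar> * ((norm (x n))\<^sup>2 + (norm (y n))\<^sup>2)"
      proof (rule mult_mono)
        have "2 * (norm (x n) * norm (y n)) \<le> (norm (x n))\<^sup>2 + (norm (y n))\<^sup>2"
          using sum_squares_bound [of "norm (x n)" "norm (y n)"] by simp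
        moreover have "0 \<le> norm (x n) * norm (y n)"
          by simp
        ultimately show "norm (x n) * norm (y n) \<le> (norm (x n))\<^sup>2 + (norm (y n))\<^sup>2"
          by linarith
      qed (use that in auto)
      finally show ?thesis .
    qed
    have "eventually (\<lambda>(n, i). norm (cinner (x n) (blinfun_apply (T i) (y n)))
        \<le> \<bar>r\<bar> * ((norm (x n))\<^sup>2 + (norm (y n))\<^sup>2)) (at_top \<times>\<^sub>F F)"
      using eventually_prodI [OF eventually_True ev, of at_top] bd
      by (auto elim!: eventually_mono)
    moreover have "summable (\<lambda>n. \<bar>r\<bar> * ((norm (x n))\<^sup>2 + (norm (y n))\<^sup>2))"
      by (intro summable_mult summable_add sx sy)
    ultimately show ?thesis
      using tannerys_theorem [of "\<lambda>n i. cinner (x n) (blinfun_apply (T i) (y n))"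
          "\<lambda>n. cinner (x n) (blinfun_apply S (y n))" F
          "\<lambda>n. \<bar>r\<bar> * ((norm (x n))\<^sup>2 + (norm (y n))\<^sup>2)"]
      by (simp add: weakly_tendstoD [OF weak] False)
  qed
  have "limitin ultraweak_topology T S F"
    unfolding ultraweak_topology_def
  proof (rule limitin_topology_generated_by)
    show "S \<in> \<Union> {{T \<in> bounded_operators.
          (\<Sum>n. cinner (x n) (blinfun_apply T (y n))) \<in> W} | x y W.
        summable (\<lambda>n::nat. (norm (x n))\<^sup>2) \<and> summable (\<lambda>n. (norm (y n))\<^sup>2) \<and> open W}"
      by (rule UnionI [of bounded_operators])
        (use M in \<open>auto intro!: exI [of _ "UNIV :: complex set"] exI [of _ "\<lambda>_. 0"]\<close>)
  next
    fix U assume "U \<in> {{T \<in> bounded_operators.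
          (\<Sum>n. cinner (x n) (blinfun_apply T (y n))) \<in> W} | x y W.
        summable (\<lambda>n::nat. (norm (x n))\<^sup>2) \<and> summable (\<lambda>n. (norm (y n))\<^sup>2) \<and> open W}"
      and S: "S \<in> U"
    then obtain x y W where
      U: "U = {T \<in> bounded_operators. (\<Sum>n. cinner (x n) (blinfun_apply T (y n))) \<in> W}"
      and "summable (\<lambda>n::nat. (norm (x n))\<^sup>2)" "summable (\<lambda>n. (norm (y n))\<^sup>2)" "open W"
      by blast
    then have "eventually (\<lambda>i. (\<Sum>n. cinner (x n) (blinfun_apply (T i) (y n))) \<in> W) F"
      using S by (intro topological_tendstoD [OF series]) auto
    with ev show "eventually (\<lambda>i. T i \<in> U) F"
      by eventually_elim (use M in \<open>auto simp: U\<close>)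
  qed
  then have "limitin (subtopology ultraweak_topology M) T S F"
    using M ev by (auto simp: limitin_subtopology elim: eventually_mono)
  then have "limitin euclidean (\<phi> \<circ> T) (\<phi> S) F"
    using \<phi> continuous_map_limit [of "subtopology ultraweak_topology M" euclidean \<phi> T S F]
    by (simp add: predual_def)
  then show ?thesis
    by (simp add: o_def)
qed simp

text \<open>
  An unbounded functional would take values of modulus at least \<open>1\<close> on a null sequence.
\<close>

lemma predual_bounded_on_balls:
  assumes \<phi>: "\<phi> \<in> predual M" and M: "M \<subseteq> bounded_operators" "0 \<in> M"
    and scale: "\<And>z T. T \<in> M \<Longrightarrow> scale_op z T \<in> M"
  obtains k where "\<And>T. T \<in> M \<Longrightarrow> norm T \<le> r \<Longrightarrow> cmod (\<phi> T) \<le> k"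
proof (rule ccontr)
  assume "\<not> thesis"
  with that have "\<forall>n. \<exists>T\<in>M. norm T \<le> r \<and> real n < cmod (\<phi> T)"
    by (meson not_le)
  then obtain T where T: "\<And>n. T n \<in> M" "\<And>n. norm (T n) \<le> r" "\<And>n. real n < cmod (\<phi> (T n))"
    by metis
  define S where "S n = scale_op (of_real (inverse (real (Suc n)))) (T (Suc n))" for n
  have S_eq: "S n = inverse (real (Suc n)) *\<^sub>R T (Suc n)" for n
    by (rule blinfun_eqI) (simp only: S_def scale_op_apply scaleC_of_real blinfun.scaleR_left)
  have S_le: "norm (S n) \<le> inverse (real (Suc n)) * r" for n
    unfolding S_eq norm_scaleR using T(2) by (simp add: mult_left_mono)
  have lim: "(\<lambda>n. inverse (real (Suc n)) * r) \<longlonglongrightarrow> 0"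
    using tendsto_mult [OF LIMSEQ_inverse_real_of_nat tendsto_const] by simp
  have S0: "S \<longlonglongrightarrow> 0"
    by (rule Lim_null_comparison [OF _ lim]) (intro always_eventually allI S_le)
  have "0 \<le> r"
    using T(2) norm_ge_zero order_trans by blast
  then have "inverse (real (Suc n)) * r \<le> r" for n
    by (intro mult_left_le_one_le) (auto simp: inverse_le_1_iff)
  then have "norm (S n) \<le> r" for n
    using S_le order_trans by blast
  then have "(\<lambda>n. \<phi> (S n)) \<longlonglongrightarrow> \<phi> 0"
    by (intro predual_tendsto [OF \<phi> M, where r = r] always_eventually
        norm_tendsto_imp_weakly_tendsto S0) (simp add: S_def T scale)
  moreover have \<phi>_scale: "\<phi> (scale_op z R) = z * \<phi> R" if "R \<in> M" for z R
    using \<phi> that by (simp add: predual_def linear_functional_on_def)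
  have "scale_op 0 0 = (0 :: 'a \<Rightarrow>\<^sub>L 'a)"
    by (rule blinfun_eqI) simp
  then have "\<phi> 0 = 0"
    using \<phi>_scale [OF M(2), of 0] by simp
  ultimately have "(\<lambda>n. cmod (\<phi> (S n))) \<longlonglongrightarrow> 0"
    using tendsto_norm_zero by fastforce
  moreover have "1 \<le> cmod (\<phi> (S n))" for n
  proof -
    have "cmod (\<phi> (S n)) = inverse (real (Suc n)) * cmod (\<phi> (T (Suc n)))"
      unfolding S_def \<phi>_scale [OF T(1)] norm_mult norm_of_real by simp
    also have "\<dots> \<ge> inverse (real (Suc n)) * real (Suc n)"
      using T(3) [of "Suc n"] by (intro mult_left_mono less_imp_le) auto
    finally show ?thesis by simp
  qed
  ultimately show False
    using LIMSEQ_le_const [of "\<lambda>n. cmod (\<phi> (S n))" 0 1] by auto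
qed

text \<open>
  Weak compactness of balls: by Tychonoff the forms \<open>cinner x (T n y)\<close> have a pointwise
  cluster point, which inherits sesquilinearity and the bound and hence comes from an operator.
\<close>

lemma bounded_sequence_weak_cluster_point:
  fixes T :: "nat \<Rightarrow> 'h::chilbert_space \<Rightarrow>\<^sub>L 'h"
  assumes T: "\<And>n. T n \<in> bounded_operators" and r: "\<And>n. norm (T n) \<le> r"
  obtains G S where "G \<le> sequentially" "G \<noteq> bot" "S \<in> bounded_operators" "weakly_tendsto T S G"
proof -
  define form where "form n = (\<lambda>(x, y). cinner x (blinfun_apply (T n) y))" for n
  define B where "B p = cball (0 :: complex) (r * norm (fst p) * norm (snd p))" for p :: "'h \<times> 'h"
  have form_le: "cmod (cinner x (blinfun_apply (T n) y)) \<le> r * norm x * norm y" for n x y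
  proof -
    have "norm (blinfun_apply (T n) y) \<le> r * norm y"
      by (rule order_trans [OF norm_blinfun]) (simp add: r mult_right_mono)
    then have "norm x * norm (blinfun_apply (T n) y) \<le> norm x * (r * norm y)"
      by (rule mult_left_mono) simp
    then show ?thesis
      using cinner_Cauchy_Schwarz [of x "blinfun_apply (T n) y"] by (simp add: mult.left_commute mult.assoc)
  qed
  have "compact (PiE UNIV B)"
    using compactin_PiE [of "\<lambda>_. euclidean" UNIV B]
    by (simp add: euclidean_product_topology B_def)
  moreover have "filtermap form sequentially \<noteq> bot"
    by (simp add: filtermap_bot_iff)
  moreover have "eventually (\<lambda>f. f \<in> PiE UNIV B) (filtermap form sequentially)"
    by (auto simp: eventually_filtermap form_def B_def PiE_iff form_le)
  ultimately obtain f where f: "inf (nhds f) (filtermap form sequentially) \<noteq> bot"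
    unfolding compact_filter by blast
  define G where "G = inf (filtercomap form (nhds f)) sequentially"
  have "G \<noteq> bot"
  proof
    assume "G = bot"
    then obtain Q R where "eventually Q (filtercomap form (nhds f))" "eventually R sequentially"
      and QR: "\<And>n. Q n \<Longrightarrow> R n \<Longrightarrow> False"
      unfolding G_def trivial_limit_def eventually_inf by blast
    then obtain Q' where Q': "eventually Q' (nhds f)" "\<And>n. Q' (form n) \<Longrightarrow> Q n"
      by (auto simp: eventually_filtercomap)
    have "eventually (\<lambda>g. \<not> Q' g) (filtermap form sequentially)"
      unfolding eventually_filtermap
      by (rule eventually_mono [OF \<open>eventually R sequentially\<close>]) (use QR Q'(2) in blast)
    with Q'(1) have "eventually (\<lambda>_. False) (inf (nhds f) (filtermap form sequentially))"
      unfolding eventually_inf by blast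
    with f show False
      by (simp add: trivial_limit_def)
  qed
  have "(form \<longlongrightarrow> f) G"
    unfolding G_def by (rule tendsto_mono [OF inf_le1 filterlim_filtercomap])
  then have "((\<lambda>n. form n p) \<longlongrightarrow> f p) G" for p
    using continuous_map_limit [OF continuous_map_product_coordinates [of p UNIV "\<lambda>_. euclidean"],
        of form f G]
    by (simp add: euclidean_product_topology o_def)
  then have lim: "((\<lambda>n. cinner x (blinfun_apply (T n) y)) \<longlongrightarrow> f (x, y)) G" for x y
    by (fastforce simp: form_def)
  note unique = tendsto_unique [OF \<open>G \<noteq> bot\<close>]
  obtain S where S: "S \<in> bounded_operators" "\<And>x y. f (x, y) = cinner x (blinfun_apply S y)"
  proof (rule bounded_form_represented [where s = "\<lambda>x y. f (x, y)"])
    fix a and x y z :: 'h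
    show "f (x + y, z) = f (x, z) + f (y, z)"
      using unique [OF lim [of "x + y" z]] tendsto_add [OF lim [of x z] lim [of y z]]
      by (simp add: cinner_add_left)
    show "f (a *\<^sub>C x, y) = cnj a * f (x, y)"
      using unique [OF lim [of "a *\<^sub>C x" y]] tendsto_mult [OF tendsto_const lim [of x y]]
      by (simp add: cinner_scaleC_left)
    show "f (x, y + z) = f (x, y) + f (x, z)"
      using unique [OF lim [of x "y + z"]] tendsto_add [OF lim [of x y] lim [of x z]]
      by (simp add: cinner_add_right blinfun.add_right)
    show "f (x, a *\<^sub>C y) = a * f (x, y)"
      using unique [OF lim [of x "a *\<^sub>C y"]] tendsto_mult [OF tendsto_const lim [of x y]]
      by (simp add: cinner_scaleC_right bounded_operatorsD [OF T])
    show "cmod (f (x, y)) \<le> r * norm x * norm y"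
      by (rule tendsto_upperbound [OF tendsto_norm [OF lim] _ \<open>G \<noteq> bot\<close>]) (simp add: form_le)
  qed (rule that)
  show thesis
  proof (rule that [OF _ \<open>G \<noteq> bot\<close> S(1)])
    show "weakly_tendsto T S G"
      using lim by (simp add: weakly_tendsto_def S(2))
  qed (simp add: G_def)
qed

section \<open>Algebras with a faithful normal tracial state\<close>

locale finite_von_neumann_algebra =
  fixes M :: "('h::chilbert_space \<Rightarrow>\<^sub>L 'h) set" and \<tau> :: "('h \<Rightarrow>\<^sub>L 'h) \<Rightarrow> complex"
  assumes algebra: "von_neumann_algebra M" and state: "faithful_normal_tracial_state M \<tau>"
begin

abbreviation radius where "radius \<equiv> numerical_radius M \<tau>"

abbreviation orbit_hull where "orbit_hull \<equiv> abs_convex_unitary_orbit M"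

lemma M_subset: "M \<subseteq> bounded_operators"
  and id_mem [simp]: "id_blinfun \<in> M"
  and add_mem [simp]: "S \<in> M \<Longrightarrow> T \<in> M \<Longrightarrow> S + T \<in> M"
  and scale_mem [simp]: "T \<in> M \<Longrightarrow> scale_op z T \<in> M"
  and compose_mem [simp]: "S \<in> M \<Longrightarrow> T \<in> M \<Longrightarrow> S o\<^sub>L T \<in> M"
  and adj_mem [simp]: "T \<in> M \<Longrightarrow> adj T \<in> M"
  and closed: "closedin weak_operator_topology M"
  using algebra by (auto simp: von_neumann_algebra_def)

lemma bounded_operator [simp]: "T \<in> M \<Longrightarrow> T \<in> bounded_operators"
  using M_subset by blast

lemma zero_mem [simp]: "0 \<in> M"
proof -
  have "scale_op 0 id_blinfun = (0 :: 'h \<Rightarrow>\<^sub>L 'h)"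
    by (rule blinfun_eqI) simp
  then show ?thesis
    using scale_mem [OF id_mem, of 0] by simp
qed

lemma diff_eq_add_scale: "S - T = S + scale_op (- 1) (T :: 'h \<Rightarrow>\<^sub>L 'h)"
  by (rule blinfun_eqI) (simp add: blinfun.diff_left blinfun.add_left scaleC_minus_left)

lemma diff_mem [simp]: "S \<in> M \<Longrightarrow> T \<in> M \<Longrightarrow> S - T \<in> M"
  by (simp add: diff_eq_add_scale)

lemma sum_mem: "(\<And>i. i \<in> I \<Longrightarrow> f i \<in> M) \<Longrightarrow> sum f I \<in> M"
  by (induction I rule: infinite_finite_induct) auto

lemma normal: "\<tau> \<in> predual M"
  and trace_one [simp]: "\<tau> id_blinfun = 1"
  and trace_nonneg: "T \<in> M \<Longrightarrow> \<tau> (adj T o\<^sub>L T) \<in> \<real>\<^sub>\<ge>\<^sub>0"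
  and trace_faithful: "T \<in> M \<Longrightarrow> \<tau> (adj T o\<^sub>L T) = 0 \<Longrightarrow> T = 0"
  using state by (auto simp: faithful_normal_tracial_state_def)

lemma trace_add: "S \<in> M \<Longrightarrow> T \<in> M \<Longrightarrow> \<tau> (S + T) = \<tau> S + \<tau> T"
  and trace_scale: "T \<in> M \<Longrightarrow> \<tau> (scale_op z T) = z * \<tau> T"
  using normal by (auto simp: predual_def linear_functional_on_def)

lemma trace_diff: "S \<in> M \<Longrightarrow> T \<in> M \<Longrightarrow> \<tau> (S - T) = \<tau> S - \<tau> T"
  by (simp add: diff_eq_add_scale trace_add trace_scale)

lemma trace_zero [simp]: "\<tau> 0 = 0"
  using trace_diff [of id_blinfun id_blinfun] by simp

lemma trace_sum: "(\<And>i. i \<in> I \<Longrightarrow> f i \<in> M) \<Longrightarrow> \<tau> (sum f I) = (\<Sum>i\<in>I. \<tau> (f i))"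
  by (induction I rule: infinite_finite_induct) (auto simp: trace_add sum_mem)

text \<open>
  Polarisation: positivity makes \<open>\<tau>\<close> real at the squares of \<open>T + c\<close>, and \<open>c = 1\<close> and
  \<open>c = \<i>\<close> yield the two halves of the identity.
\<close>

lemma trace_adj:
  assumes T: "T \<in> M"
  shows "\<tau> (adj T) = cnj (\<tau> T)"
proof -
  have real: "Im (c * \<tau> (adj T) + cnj c * \<tau> T + cnj c * c) = 0" for c
  proof -
    define R where "R = T + scale_op c id_blinfun"
    have "adj R o\<^sub>L R = (adj T o\<^sub>L T) +
        (scale_op c (adj T) + (scale_op (cnj c) T + scale_op (cnj c * c) id_blinfun))"
      by (rule blinfun_eqI)
        (use T in \<open>simp add: R_def adj_add adj_scale_op adj_id blinfun.add_left blinfun.add_right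
          scaleC_add_right scaleC_scaleC bounded_operatorsD add_ac\<close>)
    then have "\<tau> (adj R o\<^sub>L R) =
        \<tau> (adj T o\<^sub>L T) + (c * \<tau> (adj T) + (cnj c * \<tau> T + cnj c * c))"
      using T by (simp add: trace_add trace_scale)
    moreover have "Im (\<tau> (adj R o\<^sub>L R)) = 0" "Im (\<tau> (adj T o\<^sub>L T)) = 0"
      using trace_nonneg [of R] trace_nonneg [OF T] T
      by (auto simp: R_def complex_nonneg_Reals_iff)
    ultimately show ?thesis by simp
  qed
  show ?thesis
    using real [of 1] real [of \<i>] by (simp add: complex_eq_iff)
qed

text \<open>The squared norm of the pre-Hilbert space of \<open>\<tau>\<close>.\<close>

definition trace_sq :: "('h \<Rightarrow>\<^sub>L 'h) \<Rightarrow> real" where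
  "trace_sq T = Re (\<tau> (adj T o\<^sub>L T))"

lemma trace_sq_nonneg: "T \<in> M \<Longrightarrow> 0 \<le> trace_sq T"
  using trace_nonneg [of T] by (simp add: trace_sq_def complex_nonneg_Reals_iff)

lemma trace_sq_eq_0: "T \<in> M \<Longrightarrow> trace_sq T = 0 \<Longrightarrow> T = 0"
  using trace_nonneg [of T] trace_faithful [of T]
  by (simp add: trace_sq_def complex_nonneg_Reals_iff complex_eq_iff)

lemma trace_sq_add_scale:
  assumes S: "S \<in> M" and T: "T \<in> M"
  shows "trace_sq (S + scale_op (of_real c) T)
    = trace_sq S + 2 * c * Re (\<tau> (adj S o\<^sub>L T)) + c\<^sup>2 * trace_sq T"
proof -
  let ?c = "complex_of_real c"
  let ?R = "S + scale_op ?c T"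
  have "adj ?R o\<^sub>L ?R = (adj S o\<^sub>L S) +
      (scale_op ?c (adj S o\<^sub>L T) + (scale_op ?c (adj (adj S o\<^sub>L T)) + scale_op (?c * ?c) (adj T o\<^sub>L T)))"
    by (rule blinfun_eqI)
      (use S T in \<open>simp add: adj_add adj_scale_op adj_compose adj_adj blinfun.add_left
        blinfun.add_right scaleC_add_right scaleC_scaleC bounded_operatorsD add_ac\<close>)
  then have "\<tau> (adj ?R o\<^sub>L ?R) = \<tau> (adj S o\<^sub>L S) +
      (?c * \<tau> (adj S o\<^sub>L T) + (?c * cnj (\<tau> (adj S o\<^sub>L T)) + ?c * ?c * \<tau> (adj T o\<^sub>L T)))"
    using S T by (simp add: trace_add trace_scale trace_adj)
  then show ?thesis
    by (simp add: trace_sq_def power2_eq_square)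
qed

lemma trace_bounded:
  obtains k where "\<And>T. T \<in> M \<Longrightarrow> norm T \<le> r \<Longrightarrow> cmod (\<tau> T) \<le> k"
  using predual_bounded_on_balls [OF normal M_subset zero_mem scale_mem] by blast

lemma unitariesD:
  assumes "U \<in> unitaries M"
  shows "U \<in> M" "adj U o\<^sub>L U = id_blinfun" "U o\<^sub>L adj U = id_blinfun"
  using assms by (auto simp: unitaries_def)

lemma id_unitary [simp]: "id_blinfun \<in> unitaries M"
  by (simp add: unitaries_def adj_id)

lemma compose_unitary:
  assumes U: "U \<in> unitaries M" and V: "V \<in> unitaries M"
  shows "U o\<^sub>L V \<in> unitaries M"
proof -
  have "adj (U o\<^sub>L V) = adj V o\<^sub>L adj U"
    using U V by (simp add: adj_compose unitariesD)
  moreover have "(adj V o\<^sub>L adj U) o\<^sub>L (U o\<^sub>L V) = adj V o\<^sub>L (adj U o\<^sub>L U) o\<^sub>L V"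
    "(U o\<^sub>L V) o\<^sub>L (adj V o\<^sub>L adj U) = U o\<^sub>L (V o\<^sub>L adj V) o\<^sub>L adj U"
    by (auto intro: blinfun_eqI)
  ultimately show ?thesis
    using unitariesD [OF U] unitariesD [OF V] by (simp add: unitaries_def)
qed

lemma norm_isometry:
  assumes "V \<in> bounded_operators" "adj V o\<^sub>L V = id_blinfun"
  shows "norm (blinfun_apply V x) = norm x"
proof -
  have "complex_of_real ((norm (blinfun_apply V x))\<^sup>2) =
      cinner (blinfun_apply (adj V o\<^sub>L V) x) x"
    using assms(1) by (simp add: cinner_adj_left cinner_self_eq_norm)
  then have "(norm (blinfun_apply V x))\<^sup>2 = (norm x)\<^sup>2"
    by (simp add: assms(2) cinner_self_eq_norm del: of_real_power)
  then show ?thesis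
    by (simp add: power2_eq_iff_nonneg)
qed

lemma norm_unitary_conjugate_le:
  assumes U: "U \<in> unitaries M"
  shows "norm (U o\<^sub>L T o\<^sub>L adj U) \<le> norm T"
proof (rule norm_blinfun_bound)
  fix x
  have "norm (blinfun_apply (adj U) x) = norm x"
    using unitariesD [OF U] by (intro norm_isometry) (simp_all add: adj_adj)
  then show "norm (blinfun_apply (U o\<^sub>L T o\<^sub>L adj U) x) \<le> norm T * norm x"
    using unitariesD [OF U] norm_blinfun [of T "blinfun_apply (adj U) x"]
    by (simp add: norm_isometry)
qed simp

lemma norm_unitary_conjugate_compose_le:
  assumes "U \<in> unitaries M"
  shows "norm (C o\<^sub>L U o\<^sub>L T o\<^sub>L adj U) \<le> norm C * norm T"
proof -
  have "C o\<^sub>L U o\<^sub>L T o\<^sub>L adj U = C o\<^sub>L (U o\<^sub>L T o\<^sub>L adj U)"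
    by (rule blinfun_eqI) simp
  then have "norm (C o\<^sub>L U o\<^sub>L T o\<^sub>L adj U) \<le> norm C * norm (U o\<^sub>L T o\<^sub>L adj U)"
    by (simp add: norm_blinfun_compose)
  also have "\<dots> \<le> norm C * norm T"
    by (intro mult_left_mono norm_unitary_conjugate_le assms norm_ge_zero)
  finally show ?thesis .
qed

section \<open>The numerical radius\<close>

lemma le_numerical_radius:
  assumes "C \<in> M" "A \<in> M" "U \<in> unitaries M"
  shows "cmod (\<tau> (C o\<^sub>L U o\<^sub>L A o\<^sub>L adj U)) \<le> radius C A"
proof -
  obtain k where k: "\<And>T. T \<in> M \<Longrightarrow> norm T \<le> norm C * norm A \<Longrightarrow> cmod (\<tau> T) \<le> k"
    using trace_bounded by blast
  have "bdd_above ((\<lambda>U. cmod (\<tau> (C o\<^sub>L U o\<^sub>L A o\<^sub>L adj U))) ` unitaries M)"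
    using assms by (intro bdd_aboveI2 [where M = k] k norm_unitary_conjugate_compose_le)
      (simp_all add: unitariesD)
  then show ?thesis
    unfolding numerical_radius_def using assms(3) by (rule cSUP_upper2) simp
qed

lemma numerical_radius_le:
  assumes "\<And>U. U \<in> unitaries M \<Longrightarrow> cmod (\<tau> (C o\<^sub>L U o\<^sub>L A o\<^sub>L adj U)) \<le> c"
  shows "radius C A \<le> c"
  unfolding numerical_radius_def
  by (rule cSUP_least) (use assms id_unitary in blast)+

lemma numerical_radius_nonneg: "C \<in> M \<Longrightarrow> A \<in> M \<Longrightarrow> 0 \<le> radius C A"
  using le_numerical_radius [OF _ _ id_unitary, of C A] norm_ge_zero order_trans by blast

lemma numerical_radius_add_scale_le:
  assumes "C \<in> M" "D \<in> M" "A \<in> M"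
  shows "radius (C + scale_op z D) A \<le> radius C A + cmod z * radius D A"
proof (rule numerical_radius_le)
  fix U assume U: "U \<in> unitaries M"
  have "(C + scale_op z D) o\<^sub>L U o\<^sub>L A o\<^sub>L adj U =
      (C o\<^sub>L U o\<^sub>L A o\<^sub>L adj U) + scale_op z (D o\<^sub>L U o\<^sub>L A o\<^sub>L adj U)"
    by (rule blinfun_eqI) (simp add: blinfun.add_left)
  then have "\<tau> ((C + scale_op z D) o\<^sub>L U o\<^sub>L A o\<^sub>L adj U) =
      \<tau> (C o\<^sub>L U o\<^sub>L A o\<^sub>L adj U) + z * \<tau> (D o\<^sub>L U o\<^sub>L A o\<^sub>L adj U)"
    using assms unitariesD(1) [OF U] by (simp add: trace_add trace_scale)
  also have "cmod \<dots> \<le>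
      cmod (\<tau> (C o\<^sub>L U o\<^sub>L A o\<^sub>L adj U)) + cmod z * cmod (\<tau> (D o\<^sub>L U o\<^sub>L A o\<^sub>L adj U))"
    by (metis norm_mult norm_triangle_ineq)
  also have "\<dots> \<le> radius C A + cmod z * radius D A"
    using assms U by (intro add_mono mult_left_mono le_numerical_radius) auto
  finally show "cmod (\<tau> ((C + scale_op z D) o\<^sub>L U o\<^sub>L A o\<^sub>L adj U)) \<le> \<dots>" .
qed

text \<open>
  Let \<open>D\<close> be nonscalar with nonzero trace. On the line \<open>C + \<epsilon> * D\<close> at most one point is
  scalar and at most one has trace zero, so \<open>C\<close> is a limit of admissible operators, and the
  numerical radius is a seminorm in \<open>C\<close>.
\<close>

lemma numerical_radius_le_from_nonscalar_nonzero_trace: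
  assumes ns: "M \<noteq> scalar_operators" and A: "A \<in> M" and B: "B \<in> M" and C: "C \<in> M"
    and le: "\<And>C. C \<in> M \<Longrightarrow> C \<notin> scalar_operators \<Longrightarrow> \<tau> C \<noteq> 0 \<Longrightarrow> radius C A \<le> radius C B"
  shows "radius C A \<le> radius C B"
proof -
  have combine: "scale_op a S + scale_op b T \<in> scalar_operators"
    if S: "S \<in> scalar_operators" and T: "T \<in> scalar_operators"
    for S T :: "'h \<Rightarrow>\<^sub>L 'h" and a b
  proof -
    obtain z w where "S = scale_op z id_blinfun" "T = scale_op w id_blinfun"
      using S T by (auto simp: scalar_operators_def)
    then have "scale_op a S + scale_op b T = scale_op (a * z + b * w) id_blinfun"
      by (auto intro!: blinfun_eqI simp: blinfun.add_left scaleC_scaleC scaleC_add_left)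
    then show ?thesis
      by (simp add: scalar_operators_def)
  qed
  have id_scalar: "id_blinfun \<in> (scalar_operators :: ('h \<Rightarrow>\<^sub>L 'h) set)"
    unfolding scalar_operators_def
    by (rule range_eqI [of _ _ 1]) (auto intro: blinfun_eqI)
  have "scalar_operators \<subseteq> M"
    by (auto simp: scalar_operators_def)
  then obtain T where T: "T \<in> M" "T \<notin> scalar_operators"
    using ns by blast
  obtain D where D: "D \<in> M" "D \<notin> scalar_operators" "\<tau> D \<noteq> 0"
  proof (cases "\<tau> T = 0")
    case True
    have "T = scale_op 1 (T + id_blinfun) + scale_op (- 1) id_blinfun"
      by (rule blinfun_eqI) (simp add: blinfun.add_left scaleC_minus_left)
    then have "T + id_blinfun \<notin> scalar_operators"
      using T(2) combine [OF _ id_scalar, of "T + id_blinfun" 1 "- 1"] by auto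
    then show ?thesis
      using that [of "T + id_blinfun"] T(1) True by (simp add: trace_add)
  qed (use T that in blast)
  have scalar_unique: "s = t"
    if s: "C + scale_op s D \<in> scalar_operators" and t: "C + scale_op t D \<in> scalar_operators" for s t
  proof (rule ccontr)
    assume "s \<noteq> t"
    then have "D = scale_op (1 / (s - t)) (C + scale_op s D)
        + scale_op (- 1 / (s - t)) (C + scale_op t D)"
      by (intro blinfun_eqI)
        (simp add: blinfun.add_left scaleC_add_right scaleC_scaleC scaleC_minus_left
          flip: scaleC_diff_left diff_divide_distrib)
    then show False
      using combine [OF s t] D(2) by metis
  qed
  have trace_eq: "\<tau> (C + scale_op s D) = \<tau> C + s * \<tau> D" for s
    using C D by (simp add: trace_add trace_scale)
  define bad where "bad = {s. C + scale_op s D \<in> scalar_operators \<or> \<tau> (C + scale_op s D) = 0}"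
  have "finite {s. C + scale_op s D \<in> scalar_operators}"
  proof (cases "\<exists>s. C + scale_op s D \<in> scalar_operators")
    case True
    then obtain s where "C + scale_op s D \<in> scalar_operators" ..
    then have "{s. C + scale_op s D \<in> scalar_operators} \<subseteq> {s}"
      using scalar_unique by blast
    then show ?thesis
      by (rule finite_subset) simp
  qed simp
  moreover have "{s. \<tau> (C + scale_op s D) = 0} \<subseteq> {- \<tau> C / \<tau> D}"
    using D(3) by (auto simp: trace_eq field_simps add_eq_0_iff2)
  ultimately have "finite bad"
    by (simp add: bad_def Collect_disj_eq finite_subset)
  have approx: "radius C A \<le> radius C B + e * (radius D B + radius D A)" if "0 < e" for e :: real
  proof -
    have "infinite (complex_of_real ` {0<..<e})"
      using that by (simp add: finite_image_iff inj_on_def infinite_Ioo)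
    then have "\<not> complex_of_real ` {0<..<e} \<subseteq> bad"
      using \<open>finite bad\<close> finite_subset by blast
    then obtain \<epsilon> where "\<epsilon> \<in> {0<..<e}" "of_real \<epsilon> \<notin> bad"
      by blast
    then have \<epsilon>: "0 < \<epsilon>" "\<epsilon> < e" "of_real \<epsilon> \<notin> bad"
      by auto
    define C' where "C' = C + scale_op (of_real \<epsilon>) D"
    have C': "C' \<in> M"
      using C D by (simp add: C'_def)
    have "C = C' + scale_op (- of_real \<epsilon>) D"
      by (rule blinfun_eqI) (simp add: C'_def blinfun.add_left scaleC_minus_left)
    then have "radius C A \<le> radius C' A + \<epsilon> * radius D A"
      using numerical_radius_add_scale_le [OF C' D(1) A, of "- of_real \<epsilon>"] \<epsilon>(1) by simp
    also have "radius C' A \<le> radius C' B"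
      using \<epsilon>(3) C' by (intro le) (auto simp: bad_def C'_def)
    also have "radius C' B \<le> radius C B + \<epsilon> * radius D B"
      using numerical_radius_add_scale_le [OF C D(1) B, of "of_real \<epsilon>"] \<epsilon>(1) by (simp add: C'_def)
    finally have "radius C A \<le> radius C B + \<epsilon> * (radius D B + radius D A)"
      by (simp add: distrib_left)
    also have "\<dots> \<le> radius C B + e * (radius D B + radius D A)"
      using \<epsilon>(2) A B D(1) by (intro add_left_mono mult_right_mono)
        (simp_all add: numerical_radius_nonneg)
    finally show ?thesis .
  qed
  have "((\<lambda>e. radius C B + e * (radius D B + radius D A)) \<longlongrightarrow>
      radius C B + 0 * (radius D B + radius D A)) (at_right 0)"
    by (intro tendsto_intros)
  then show ?thesis
    by (rule tendsto_lowerbound [where a = "radius C A", THEN order_trans])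
      (auto intro: eventually_mono [OF eventually_at_right_less approx])
qed

section \<open>The absolutely convex hull of the unitary orbit\<close>

lemma orbit_hullE:
  assumes "T \<in> orbit_hull B"
  obtains n :: nat and U z where "T = (\<Sum>i=1..n. scale_op (z i) (U i o\<^sub>L B o\<^sub>L adj (U i)))"
    "\<And>i. i \<in> {1..n} \<Longrightarrow> U i \<in> unitaries M" "(\<Sum>i=1..n. cmod (z i)) \<le> 1"
  using assms unfolding abs_convex_unitary_orbit_def by blast

lemma zero_in_orbit_hull: "0 \<in> orbit_hull B"
proof -
  have "0 = (\<Sum>i=1..0::nat. scale_op 0 (id_blinfun o\<^sub>L B o\<^sub>L adj id_blinfun))"
    by simp
  then show ?thesis
    unfolding abs_convex_unitary_orbit_def
    by (intro CollectI exI [of _ 0] exI [of _ "\<lambda>_. id_blinfun"] exI [of _ "\<lambda>_. 0"]) simp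
qed

lemma orbit_hull_mem: "B \<in> M \<Longrightarrow> T \<in> orbit_hull B \<Longrightarrow> T \<in> M"
  by (erule orbit_hullE) (auto intro!: sum_mem scale_mem compose_mem adj_mem intro: unitariesD(1))

lemma norm_scale_op_le: "norm (scale_op z T) \<le> cmod z * norm T"
proof (rule norm_blinfun_bound)
  show "norm (blinfun_apply (scale_op z T) x) \<le> cmod z * norm T * norm x" for x
    by (simp add: norm_scaleC mult.assoc mult_left_mono norm_blinfun)
qed simp

lemma norm_orbit_hull_le:
  assumes "T \<in> orbit_hull B"
  shows "norm T \<le> norm B"
  using assms
proof (rule orbit_hullE)
  fix n :: nat and U z
  assume T: "T = (\<Sum>i=1..n. scale_op (z i) (U i o\<^sub>L B o\<^sub>L adj (U i)))"
    and U: "\<And>i. i \<in> {1..n} \<Longrightarrow> U i \<in> unitaries M" and z: "(\<Sum>i=1..n. cmod (z i)) \<le> 1"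
  have "norm T \<le> (\<Sum>i=1..n. cmod (z i) * norm B)"
    unfolding T
    by (intro sum_norm_le order_trans [OF norm_scale_op_le] mult_left_mono
        norm_unitary_conjugate_le U norm_ge_zero)
  also have "\<dots> \<le> norm B"
    using mult_right_mono [OF z, of "norm B"] by (simp add: sum_distrib_right)
  finally show ?thesis .
qed

text \<open>
  Together with \<open>0\<close> being in the hull this is all of its absolute convexity that the
  separation argument uses.
\<close>

lemma orbit_hull_convex_step:
  assumes P: "P \<in> orbit_hull B" and V: "V \<in> unitaries M" and w: "cmod w \<le> 1"
    and t: "0 \<le> t" "t \<le> 1"
  shows "scale_op (of_real (1 - t)) P + scale_op (of_real t * w) (V o\<^sub>L B o\<^sub>L adj V) \<in> orbit_hull B"
  using P
proof (rule orbit_hullE)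
  fix n :: nat and U z
  assume P: "P = (\<Sum>i=1..n. scale_op (z i) (U i o\<^sub>L B o\<^sub>L adj (U i)))"
    and U: "\<And>i. i \<in> {1..n} \<Longrightarrow> U i \<in> unitaries M" and z: "(\<Sum>i=1..n. cmod (z i)) \<le> 1"
  define U' where "U' = U(Suc n := V)"
  define z' where "z' i = (if i = Suc n then of_real t * w else of_real (1 - t) * z i)" for i
  have scale_sum: "scale_op c (sum f I) = (\<Sum>i\<in>I. scale_op c (f i))"
    for c and f :: "nat \<Rightarrow> 'h \<Rightarrow>\<^sub>L 'h" and I
    by (rule blinfun_eqI)
      (simp add: blinfun.sum_left linear_sum [OF bounded_linear.linear [OF bounded_linear_scaleC]])
  have scale_scale: "scale_op a (scale_op b T) = scale_op (a * b) T"
    for a b and T :: "'h \<Rightarrow>\<^sub>L 'h"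
    by (rule blinfun_eqI) (simp add: scaleC_scaleC)
  have old: "(\<Sum>i=1..n. g (z' i) (U' i)) = (\<Sum>i=1..n. g (of_real (1 - t) * z i) (U i))"
    for g :: "complex \<Rightarrow> ('h \<Rightarrow>\<^sub>L 'h) \<Rightarrow> 'b::comm_monoid_add"
    by (intro sum.cong) (auto simp: U'_def z'_def)
  have "(\<Sum>i=1..Suc n. scale_op (z' i) (U' i o\<^sub>L B o\<^sub>L adj (U' i))) =
      scale_op (of_real (1 - t)) P + scale_op (of_real t * w) (V o\<^sub>L B o\<^sub>L adj V)"
    using old [of "\<lambda>z U. scale_op z (U o\<^sub>L B o\<^sub>L adj U)"]
    by (simp add: P scale_sum scale_scale U'_def z'_def)
  moreover have "(\<Sum>i=1..Suc n. cmod (z' i)) \<le> 1"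
  proof -
    have "(\<Sum>i=1..Suc n. cmod (z' i)) = (1 - t) * (\<Sum>i=1..n. cmod (z i)) + t * cmod w"
      using old [of "\<lambda>z U. cmod z"] t
      by (simp add: z'_def norm_mult sum_distrib_left del: of_real_diff)
    also have "\<dots> \<le> (1 - t) * 1 + t * 1"
      using t z w by (intro add_mono mult_left_mono) auto
    finally show ?thesis by simp
  qed
  moreover have "\<forall>i\<in>{1..Suc n}. U' i \<in> unitaries M"
    using U V by (auto simp: U'_def)
  ultimately show ?thesis
    unfolding abs_convex_unitary_orbit_def
    by (intro CollectI exI [of _ "Suc n"] exI [of _ U'] exI [of _ z'] conjI) (rule sym)
qed

text \<open>
  Conjugating by \<open>U\<close> merely replaces the unitaries \<open>V i\<close> of the combination by \<open>U V i\<close>, so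
  the triangle inequality suffices.
\<close>

lemma orbit_hull_numerical_radius:
  assumes C: "C \<in> M" and B: "B \<in> M" and U: "U \<in> unitaries M" and T: "T \<in> orbit_hull B"
  shows "cmod (\<tau> (C o\<^sub>L U o\<^sub>L T o\<^sub>L adj U)) \<le> radius C B"
  using T
proof (rule orbit_hullE)
  fix n :: nat and V z
  assume T: "T = (\<Sum>i=1..n. scale_op (z i) (V i o\<^sub>L B o\<^sub>L adj (V i)))"
    and V: "\<And>i. i \<in> {1..n} \<Longrightarrow> V i \<in> unitaries M" and z: "(\<Sum>i=1..n. cmod (z i)) \<le> 1"
  let ?W = "\<lambda>i. U o\<^sub>L V i"
  have UM: "U \<in> M"
    using U by (rule unitariesD)
  have VM: "V i \<in> M" if "i \<in> {1..n}" for i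
    using V [OF that] by (rule unitariesD)
  have "C o\<^sub>L U o\<^sub>L T o\<^sub>L adj U =
      (\<Sum>i=1..n. scale_op (z i) (C o\<^sub>L ?W i o\<^sub>L B o\<^sub>L adj (?W i)))"
    by (rule blinfun_eqI)
      (use C UM VM in \<open>simp add: T blinfun.sum_left blinfun.sum_right adj_compose
        bounded_operatorsD\<close>)
  moreover have "C o\<^sub>L ?W i o\<^sub>L B o\<^sub>L adj (?W i) \<in> M" if "i \<in> {1..n}" for i
    using C B UM VM [OF that] by simp
  ultimately have "\<tau> (C o\<^sub>L U o\<^sub>L T o\<^sub>L adj U) =
      (\<Sum>i=1..n. z i * \<tau> (C o\<^sub>L ?W i o\<^sub>L B o\<^sub>L adj (?W i)))"
    by (simp only: trace_sum trace_scale scale_mem cong: sum.cong)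
  also have "cmod \<dots> \<le> (\<Sum>i=1..n. cmod (z i) * radius C B)"
    using U V C B
    by (intro sum_norm_le) (simp add: norm_mult mult_left_mono le_numerical_radius compose_unitary)
  also have "\<dots> \<le> radius C B"
    using mult_right_mono [OF z numerical_radius_nonneg [OF C B]] by (simp add: sum_distrib_right)
  finally show ?thesis .
qed

section \<open>Separation in the norm of the trace\<close>

text \<open>
  Suppose that \<open>A\<close> has squared distance \<open>d > 0\<close> from the hull in the norm given by \<open>\<tau>\<close> and that \<open>P\<close> in
  the hull almost attains it. Moving from \<open>P\<close> towards another point of the hull cannot bring \<open>A\<close>
  much closer, so the hyperplane through \<open>P\<close> orthogonal to \<open>A - P\<close> almost supports
  the hull, and \<open>C = adj (A - P)\<close> satisfies \<open>radius C B < radius C A\<close>.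
\<close>

lemma orbit_hull_approximates:
  assumes A: "A \<in> M" and B: "B \<in> M"
    and le: "\<And>C. C \<in> M \<Longrightarrow> radius C A \<le> radius C B" and "0 < \<epsilon>"
  shows "\<exists>P\<in>orbit_hull B. trace_sq (A - P) < \<epsilon>"
proof (rule ccontr)
  assume "\<not> ?thesis"
  then have far: "\<epsilon> \<le> trace_sq (A - P)" if "P \<in> orbit_hull B" for P
    using that not_less by blast
  define d where "d = (INF P\<in>orbit_hull B. trace_sq (A - P))"
  have bdd: "bdd_below ((\<lambda>P. trace_sq (A - P)) ` orbit_hull B)"
    using far by (intro bdd_belowI2)
  have d_le: "d \<le> trace_sq (A - P)" if "P \<in> orbit_hull B" for P
    unfolding d_def by (rule cINF_lower [OF bdd that])
  have "\<epsilon> \<le> d"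
    unfolding d_def using zero_in_orbit_hull [of B] far by (intro cINF_greatest) auto
  then have "0 < d"
    using \<open>0 < \<epsilon>\<close> by simp
  obtain R where R: "0 < R" "\<And>T. T \<in> M \<Longrightarrow> norm T \<le> 2 * norm B \<Longrightarrow> trace_sq T \<le> R"
  proof -
    obtain k where k: "\<And>T. T \<in> M \<Longrightarrow> norm T \<le> 2 * norm B * (2 * norm B) \<Longrightarrow> cmod (\<tau> T) \<le> k"
      using trace_bounded by blast
    have "trace_sq T \<le> max k 1" if "T \<in> M" "norm T \<le> 2 * norm B" for T
    proof -
      have "norm (adj T) \<le> 2 * norm B"
        using norm_adj_le [of T] that by simp
      then have "norm (adj T o\<^sub>L T) \<le> 2 * norm B * (2 * norm B)"
        using that(2) by (intro order_trans [OF norm_blinfun_compose] mult_mono) auto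
      then have "cmod (\<tau> (adj T o\<^sub>L T)) \<le> k"
        using that(1) by (intro k) simp_all
      then show ?thesis
        unfolding trace_sq_def using complex_Re_le_cmod [of "\<tau> (adj T o\<^sub>L T)"] by linarith
    qed
    then show ?thesis
      using that [of "max k 1"] by simp
  qed
  \<comment> \<open>With this step length and this accuracy of \<open>P\<close>, the first-order error and the quadratic
    term below cost a quarter of \<open>d\<close> each.\<close>
  define t where "t = min 1 (d / (2 * R))"
  have t: "0 < t" "t \<le> 1" "t * R \<le> d / 2"
  proof -
    have "t * R \<le> d / (2 * R) * R"
      using R(1) by (intro mult_right_mono) (simp_all add: t_def)
    then show "t * R \<le> d / 2"
      using R(1) by simp
  qed (use \<open>0 < d\<close> R(1) in \<open>simp_all add: t_def\<close>)
  have "\<exists>P\<in>orbit_hull B. trace_sq (A - P) < d + t * d / 2"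
    using cINF_less_iff [OF _ bdd, of "d + t * d / 2"] zero_in_orbit_hull [of B] t(1) \<open>0 < d\<close>
    by (auto simp flip: d_def)
  then obtain P where P: "P \<in> orbit_hull B" "trace_sq (A - P) < d + t * d / 2"
    by blast
  have PM: "P \<in> M"
    using P(1) B orbit_hull_mem by blast
  define C where "C = adj (A - P)"
  have CM: "C \<in> M"
    using A PM by (simp add: C_def)
  have supporting: "Re (\<tau> (C o\<^sub>L scale_op w (V o\<^sub>L B o\<^sub>L adj V))) \<le> Re (\<tau> (C o\<^sub>L A)) - d / 2"
    if V: "V \<in> unitaries M" and w: "cmod w \<le> 1" for V w
  proof -
    define Q where "Q = scale_op w (V o\<^sub>L B o\<^sub>L adj V)"
    have QM: "Q \<in> M"
      using V B by (simp add: Q_def unitariesD)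
    have "norm Q \<le> 1 * norm B"
      unfolding Q_def using w norm_unitary_conjugate_le [OF V]
      by (intro order_trans [OF norm_scale_op_le] mult_mono) auto
    then have "norm (Q - P) \<le> 2 * norm B"
      using norm_orbit_hull_le [OF P(1)] norm_triangle_ineq4 [of Q P] by simp
    then have qR: "trace_sq (Q - P) \<le> R"
      using QM PM by (intro R) simp_all
    define P' where "P' = scale_op (of_real (1 - t)) P + scale_op (of_real t * w) (V o\<^sub>L B o\<^sub>L adj V)"
    have "P' \<in> orbit_hull B"
      unfolding P'_def using t by (intro orbit_hull_convex_step P(1) V w) auto
    have "A - P' = (A - P) + scale_op (of_real (- t)) (Q - P)"
      by (rule blinfun_eqI)
        (simp add: P'_def Q_def blinfun.add_left blinfun.diff_left scaleC_scaleC scaleC_diff_left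
          scaleC_minus_left scaleC_diff_right)
    then have "trace_sq (A - P') =
        trace_sq (A - P) + 2 * (- t) * Re (\<tau> (C o\<^sub>L (Q - P))) + (- t)\<^sup>2 * trace_sq (Q - P)"
      unfolding C_def using A PM QM by (simp only: trace_sq_add_scale diff_mem)
    moreover have "d \<le> trace_sq (A - P')"
      by (rule d_le) fact
    moreover have "(- t)\<^sup>2 * trace_sq (Q - P) \<le> t * (d / 2)"
    proof -
      have "(- t)\<^sup>2 * trace_sq (Q - P) \<le> (- t)\<^sup>2 * R"
        by (intro mult_left_mono qR) simp
      also have "\<dots> = t * (t * R)"
        by (simp add: power2_eq_square)
      also have "\<dots> \<le> t * (d / 2)"
        using t by (intro mult_left_mono) auto
      finally show ?thesis .
    qed
    ultimately have "t * (2 * Re (\<tau> (C o\<^sub>L (Q - P)))) \<le> t * d"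
      using P(2) by (simp add: algebra_simps)
    then have "2 * Re (\<tau> (C o\<^sub>L (Q - P))) \<le> d"
      using t(1) by simp
    moreover have "C o\<^sub>L (Q - P) = (C o\<^sub>L Q) + (C o\<^sub>L (A - P)) - (C o\<^sub>L A)"
      by (rule blinfun_eqI) (simp add: blinfun.add_left blinfun.diff_left blinfun.diff_right)
    then have "Re (\<tau> (C o\<^sub>L (Q - P))) = Re (\<tau> (C o\<^sub>L Q)) + trace_sq (A - P) - Re (\<tau> (C o\<^sub>L A))"
      using CM QM PM A by (simp add: trace_diff trace_add trace_sq_def flip: C_def)
    ultimately show ?thesis
      using d_le [OF P(1)] by (simp add: Q_def)
  qed
  have "radius C B \<le> Re (\<tau> (C o\<^sub>L A)) - d / 2"
  proof (rule numerical_radius_le)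
    fix V assume V: "V \<in> unitaries M"
    define v where "v = \<tau> (C o\<^sub>L V o\<^sub>L B o\<^sub>L adj V)"
    \<comment> \<open>For \<open>v = 0\<close> the phase is \<open>0\<close>.\<close>
    define w where "w = cnj v / of_real (cmod v)"
    have "w * v = of_real (cmod v)"
      using complex_norm_square [of v]
      by (cases "v = 0") (simp_all add: w_def power2_eq_square mult.commute nonzero_divide_eq_eq)
    moreover have "C o\<^sub>L scale_op w (V o\<^sub>L B o\<^sub>L adj V) = scale_op w (C o\<^sub>L V o\<^sub>L B o\<^sub>L adj V)"
      by (rule blinfun_eqI) (use CM in \<open>simp add: bounded_operatorsD\<close>)
    ultimately have "\<tau> (C o\<^sub>L scale_op w (V o\<^sub>L B o\<^sub>L adj V)) = of_real (cmod v)"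
      using CM B unitariesD(1) [OF V] by (simp add: trace_scale flip: v_def)
    moreover have "cmod w \<le> 1"
      by (simp add: w_def norm_divide)
    ultimately show "cmod (\<tau> (C o\<^sub>L V o\<^sub>L B o\<^sub>L adj V)) \<le> Re (\<tau> (C o\<^sub>L A)) - d / 2"
      using supporting [OF V, of w] by (simp add: v_def)
  qed
  also have "\<dots> < cmod (\<tau> (C o\<^sub>L A))"
    using complex_Re_le_cmod [of "\<tau> (C o\<^sub>L A)"] \<open>0 < d\<close> by linarith
  also have "\<dots> \<le> radius C A"
    using le_numerical_radius [OF CM A id_unitary] by (simp add: adj_id)
  finally show False
    using le [OF CM] by simp
qed

text \<open>
  A sequence \<open>P n\<close> of the hull approximating \<open>A\<close> in the norm given by \<open>\<tau>\<close> has a weak cluster point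
  \<open>S\<close>, as the hull is bounded. With \<open>X = A - S\<close>, the weak limit of \<open>A - P n\<close>, expanding
  \<open>trace_sq (A - P n - X) \<ge> 0\<close> yields \<open>trace_sq X \<le> 0\<close> in the limit, so \<open>S = A\<close> by
  faithfulness.
\<close>

lemma in_closure_if_numerical_radius_le:
  assumes A: "A \<in> M" and B: "B \<in> M"
    and le: "\<And>C. C \<in> M \<Longrightarrow> radius C A \<le> radius C B"
  shows "A \<in> weak_operator_topology closure_of orbit_hull B"
proof -
  have "\<forall>n. \<exists>P\<in>orbit_hull B. trace_sq (A - P) < inverse (real (Suc n))"
    using orbit_hull_approximates [OF A B le] by simp
  then obtain P where P: "\<And>n. P n \<in> orbit_hull B"
    and P_lt: "\<And>n. trace_sq (A - P n) < inverse (real (Suc n))"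
    by metis
  have PM: "P n \<in> M" for n
    using P B orbit_hull_mem by blast
  obtain G S where G: "G \<le> sequentially" "G \<noteq> bot" and S: "S \<in> bounded_operators"
    and weak: "weakly_tendsto P S G"
    using bounded_sequence_weak_cluster_point [of P "norm B"] PM norm_orbit_hull_le [OF P]
      bounded_operator by blast
  have lim: "limitin weak_operator_topology P S G"
    by (rule limitin_weak_operator_topology [OF S _ weak]) (simp add: PM)
  have SM: "S \<in> M"
    by (rule limitin_closedin [OF lim closed]) (simp_all add: PM G)
  have "orbit_hull B \<subseteq> topspace weak_operator_topology"
    using closedin_subset [OF closed] B orbit_hull_mem by blast
  then have in_closure: "orbit_hull B \<subseteq> weak_operator_topology closure_of orbit_hull B"
    by (rule closure_of_subset)
  have S_closure: "S \<in> weak_operator_topology closure_of orbit_hull B"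
    by (rule limitin_closedin [OF lim closedin_closure_of]) (use P in_closure G in \<open>auto intro!: always_eventually\<close>)
  define X where "X = A - S"
  have XM: "X \<in> M"
    using A SM by (simp add: X_def)
  have bound: "norm (adj X o\<^sub>L (A - P n)) \<le> norm (adj X) * (norm A + norm B)" for n
  proof -
    have "norm (A - P n) \<le> norm A + norm B"
      using norm_triangle_ineq4 [of A "P n"] norm_orbit_hull_le [OF P, of n] by simp
    then show ?thesis
      by (intro order_trans [OF norm_blinfun_compose] mult_left_mono) auto
  qed
  have "((\<lambda>n. \<tau> (adj X o\<^sub>L (A - P n))) \<longlongrightarrow> \<tau> (adj X o\<^sub>L X)) G"
  proof (rule predual_tendsto [OF normal M_subset])
    show "\<forall>\<^sub>F n in G. adj X o\<^sub>L (A - P n) \<in> M \<and>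
        norm (adj X o\<^sub>L (A - P n)) \<le> norm (adj X) * (norm A + norm B)"
      using bound A PM XM by simp
    show "weakly_tendsto (\<lambda>n. adj X o\<^sub>L (A - P n)) (adj X o\<^sub>L X) G"
      unfolding X_def using A SM by (intro weakly_tendsto_compose_left weakly_tendsto_diff weak) simp
  qed (use XM in simp)
  then have "((\<lambda>n. inverse (real (Suc n)) + 2 * (- 1) * Re (\<tau> (adj X o\<^sub>L (A - P n))) + trace_sq X) \<longlongrightarrow>
      0 + 2 * (- 1) * Re (\<tau> (adj X o\<^sub>L X)) + trace_sq X) G"
    by (intro tendsto_intros tendsto_mono [OF G(1) LIMSEQ_inverse_real_of_nat])
  moreover have "0 \<le> inverse (real (Suc n)) + 2 * (- 1) * Re (\<tau> (adj X o\<^sub>L (A - P n))) + trace_sq X" for n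
  proof -
    have AP: "A - P n \<in> M"
      using A PM by simp
    have "0 \<le> trace_sq (X + scale_op (of_real (- 1)) (A - P n))"
      using XM AP by (intro trace_sq_nonneg add_mem scale_mem)
    also have "\<dots> = trace_sq X + 2 * (- 1) * Re (\<tau> (adj X o\<^sub>L (A - P n))) + trace_sq (A - P n)"
      unfolding trace_sq_add_scale [OF XM AP] by simp
    finally show ?thesis
      using P_lt [of n] by linarith
  qed
  ultimately have "0 \<le> 0 + 2 * (- 1) * Re (\<tau> (adj X o\<^sub>L X)) + trace_sq X"
    by (rule tendsto_lowerbound [OF _ always_eventually [OF allI] G(2)])
  then have "trace_sq X = 0"
    using trace_sq_nonneg [OF XM] by (simp add: trace_sq_def)
  then have "A = S"
    using trace_sq_eq_0 [OF XM] by (simp add: X_def)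
  then show ?thesis
    using S_closure by simp
qed

text \<open>
  For fixed \<open>U\<close> the functional \<open>T \<mapsto> \<tau> (C U T adj U)\<close> is weakly continuous on the hull, which is
  bounded, and it is bounded by \<open>radius C B\<close> there.
\<close>

lemma numerical_radius_le_if_in_closure:
  assumes A: "A \<in> M" and B: "B \<in> M" and C: "C \<in> M"
    and closure: "A \<in> weak_operator_topology closure_of orbit_hull B"
  shows "radius C A \<le> radius C B"
proof (rule numerical_radius_le)
  fix U assume U: "U \<in> unitaries M"
  have UM: "U \<in> M"
    using U by (rule unitariesD)
  define F where "F = inf (nhdsin weak_operator_topology A) (principal (orbit_hull B))"
  have A_top: "A \<in> topspace weak_operator_topology"
    using closedin_subset [OF closed] A by blast
  have "F \<noteq> bot"
    using closure A_top
    by (auto simp: F_def trivial_limit_def eventually_inf_principal eventually_nhdsin in_closure_of)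
  have in_hull: "eventually (\<lambda>T. T \<in> orbit_hull B) F"
    by (simp add: F_def eventually_inf_principal)
  have weak: "weakly_tendsto (\<lambda>T. T) A F"
    unfolding weakly_tendsto_def
  proof (intro allI topological_tendstoI)
    fix x y W assume W: "open W" "cinner x (blinfun_apply A y) \<in> W"
    define V where "V = {T \<in> bounded_operators. cinner x (blinfun_apply T y) \<in> W}"
    have "openin weak_operator_topology V"
      unfolding weak_operator_topology_def V_def using W(1)
      by (intro topology_generated_by_Basis) blast
    moreover have "A \<in> V"
      using W A by (simp add: V_def)
    ultimately show "eventually (\<lambda>T. cinner x (blinfun_apply T y) \<in> W) F"
      by (auto simp: F_def eventually_inf_principal eventually_nhdsin V_def)
  qed
  have "((\<lambda>T. \<tau> (C o\<^sub>L U o\<^sub>L T o\<^sub>L adj U)) \<longlongrightarrow> \<tau> (C o\<^sub>L U o\<^sub>L A o\<^sub>L adj U)) F"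
  proof (rule predual_tendsto [OF normal M_subset])
    show "\<forall>\<^sub>F T in F. C o\<^sub>L U o\<^sub>L T o\<^sub>L adj U \<in> M \<and>
        norm (C o\<^sub>L U o\<^sub>L T o\<^sub>L adj U) \<le> norm C * norm B"
      using in_hull
    proof eventually_elim
      case (elim T)
      have "norm C * norm T \<le> norm C * norm B"
        by (intro mult_left_mono norm_orbit_hull_le elim norm_ge_zero)
      then show ?case
        using norm_unitary_conjugate_compose_le [OF U, of C T] C UM orbit_hull_mem [OF B elim]
        by simp
    qed
    show "weakly_tendsto (\<lambda>T. C o\<^sub>L U o\<^sub>L T o\<^sub>L adj U) (C o\<^sub>L U o\<^sub>L A o\<^sub>L adj U) F"
      using C UM by (intro weakly_tendsto_compose_right weakly_tendsto_compose_left weak) simp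
  qed (use C UM A in simp)
  then show "cmod (\<tau> (C o\<^sub>L U o\<^sub>L A o\<^sub>L adj U)) \<le> radius C B"
    by (rule tendsto_upperbound [OF tendsto_norm _ \<open>F \<noteq> bot\<close>])
      (rule eventually_mono [OF in_hull orbit_hull_numerical_radius [OF C B U]])
qed

end

theorem theorem4p2:
  fixes M :: "('h::chilbert_space \<Rightarrow>\<^sub>L 'h) set"
    and \<tau> :: "('h \<Rightarrow>\<^sub>L 'h) \<Rightarrow> complex"
    and A B :: "'h \<Rightarrow>\<^sub>L 'h"
  assumes "factor M"
    and "separable_predual M"
    and "faithful_normal_tracial_state M \<tau>"
    and "A \<in> M" and "B \<in> M"
  shows "(M \<noteq> scalar_operators \<longrightarrow>
            ((\<forall>C\<in>M. C \<notin> scalar_operators \<and> \<tau> C \<noteq> 0 \<longrightarrow>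
                numerical_radius M \<tau> C A \<le> numerical_radius M \<tau> C B) \<longleftrightarrow>
             (\<forall>C\<in>M. numerical_radius M \<tau> C A \<le> numerical_radius M \<tau> C B))) \<and>
         ((\<forall>C\<in>M. numerical_radius M \<tau> C A \<le> numerical_radius M \<tau> C B) \<longleftrightarrow>
             A \<in> weak_operator_topology closure_of (abs_convex_unitary_orbit M B))"
proof -
  interpret finite_von_neumann_algebra M \<tau>
    using assms by unfold_locales (simp_all add: factor_def)
  show ?thesis
    using numerical_radius_le_from_nonscalar_nonzero_trace [OF _ assms(4,5)]
      in_closure_if_numerical_radius_le [OF assms(4,5)]
      numerical_radius_le_if_in_closure [OF assms(4,5)]
    by blast
qed

end
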